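(* Suppose Assumptions (A1)--(A4) of the context hold and let $\kappa = \frac{B_f^2}{\gamma\mu} + \frac{B_w^2B_\theta^2}{\mu^2}$. Run the algorithm SVRPDA-I (described in the context) with Option I and with $$\alpha_\theta=\frac{1}{n_X\mu(64\kappa+1)},\qquad \alpha_w=\frac{n_X\mu}{\gamma}\alpha_\theta,\qquad M=\lceil 78.8\,n_X\kappa+1.3\,n_X+1.3\rceil .$$ Then the Lyapunov function $$P_s := \mathsf{E}\|\tilde\theta_s-\theta^*\|^2+\frac{\gamma}{\mu}\cdot\frac{64\kappa+3}{64n_X\kappa+n_X+1}\,\mathsf{E}\|\tilde w_s-w^*\|^2$$ satisfies $P_s\le (3/4)^sP_0$ for all $s \geq 0$. Furthermore, the overall computational cost, in number of oracle calls, for reaching $P_s\le\epsilon$ is upper bounded by $$O\big((n_Xn_Y+n_X\kappa+n_X)\ln(1/\epsilon)\big),\qquad n_Y:=\frac{n_{Y_0}+\cdots+n_{Y_{n_X-1}}}{n_X}.$$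
   Context: Problem. Let $n_X\ge1$ and $n_{Y_i}\ge 1$ ($0\le i<n_X$) be integers, and let $(x_i,y_{ij})\in\mathbb{R}^{m_x}\times\mathbb{R}^{m_y}$ ($0\le i<n_X$, $0\le j<n_{Y_i}$) be given data. Let $f_\theta:\mathbb{R}^{m_x}\times\mathbb{R}^{m_y}\to\mathbb{R}^\ell$ be a function parameterized by $\theta\in\mathbb{R}^d$, differentiable in $\theta$; $f'_\theta(x,y)$ denotes the $d\times\ell$ matrix with $(a,b)$ entry $\partial [f_\theta(x,y)]_b/\partial\theta_a$. Let $\phi_i:\mathbb{R}^\ell\to\mathbb{R}^+$ be convex, with convex conjugate $\phi_i^*(w)=\sup_u(\langle u,w\rangle-\phi_i(u))$, and let $g$ be a convex function on $\mathbb{R}^d$. The problem is $\min_\theta \frac1{n_X}\sum_{i=0}^{n_X-1}\phi_i\big(\frac1{n_{Y_i}}\sum_{j=0}^{n_{Y_i}-1}f_\theta(x_i,y_{ij})\big)+g(\theta)$, equivalently the saddle point problem $\min_\theta\max_w\{L(\theta,w)+g(\theta)\}$ with $w=(w_0,\dots,w_{n_X-1})\in\mathbb{R}^{\ell n_X}$ and $$L(\theta,w)=\frac1{n_X}\sum_{i=0}^{n_X-1}\Big[\Big\langle\frac1{n_{Y_i}}\sum_{j=0}^{n_{Y_i}-1}f_\theta(x_i,y_{ij}),w_i\Big\rangle-\phi_i^*(w_i)\Big].$$ $(\theta^*,w^* )$ denotes the saddle point: $\theta^*=\arg\min_\theta[L(\theta,w^* )+g(\theta)]$ and $w_i^*=\arg\min_{w_i}[\phi_i^*(w_i)-\langle\overline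 f_i(\theta^* ),w_i\rangle]$ for all $i$. Notation: $\overline f_i(\theta)=\frac1{n_{Y_i}}\sum_jf_\theta(x_i,y_{ij})$, $\overline f_i'(\theta)=\frac1{n_{Y_i}}\sum_jf'_\theta(x_i,y_{ij})$; $\|\cdot\|$ is the Euclidean norm for vectors (so $\|w\|^2=\sum_i\|w_i\|^2$) and the operator norm for matrices. Assumptions (with positive constants $\mu,\gamma,B_w,B_\theta,B_f$). (A1) $g$ is $\mu$-strongly convex, and each $\phi_i$ is $1/\gamma$-smooth (its gradient is $1/\gamma$-Lipschitz). (A2) $|\phi_i(u)-\phi_i(u')|\le B_w\|u-u'\|$ for all $u,u'$ and all $i$. (A3) $\|f'_{\theta_1}(x_i,y_{ij})-f'_{\theta_2}(x_i,y_{ij})\|\le B_\theta\|\theta_1-\theta_2\|$ and $\|f'_\theta(x_i,y_{ij})\|\le B_f$ for all $\theta,\theta_1,\theta_2$ and all $i,j$. (A4) For each given $w$ in its domain (i.e. $\phi_i^*(w_i)<\infty$ for all $i$), $L(\cdot,w)$ is convex: $L(\theta_1,w)-L(\theta_2,w)\ge\langle L'_\theta(\theta_2,w),\theta_1-\theta_2\rangle$ for all $\theta_1,\theta_2$, where $L'_\theta$ is the gradient in $\theta$. Algorithm SVRPDA-I. Inputs: step-sizes $\alpha_\theta,\alpha_w>0$, number of inner iterations $M$. Initialize $\tilde\theta_0\in\mathbb{R}^d$, $\tilde w_0\in\mathbb{R}^{\ell n_X}$. For each outer iteration (stage) $s=1,2,\dots$: set $\tilde\theta=\theta^{(0)}=\tilde\theta_{s-1}$,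 $w^{(0)}=\tilde w_{s-1}$; compute $U_0=\sum_{i}\sum_{j}\frac{1}{n_Xn_{Y_i}}f'_{\tilde\theta}(x_i,y_{ij})w_i^{(0)}$, and $\overline f_i(\tilde\theta)$, $\overline f'_i(\tilde\theta)$ for all $i$. For $k=1,\dots,M$: (1) sample $i_k$ uniformly from $\{0,\dots,n_X-1\}$, then $j_k$ uniformly from $\{0,\dots,n_{Y_{i_k}}-1\}$; set $\delta_k^w=f_{\theta^{(k-1)}}(x_{i_k},y_{i_kj_k})-f_{\tilde\theta}(x_{i_k},y_{i_kj_k})+\overline f_{i_k}(\tilde\theta)$. (2) $w^{(k)}_{i_k}=\arg\min_{v}\big[-\langle\delta_k^w,v\rangle+\phi_{i_k}^*(v)+\frac1{2\alpha_w}\|v-w^{(k-1)}_{i_k}\|^2\big]$, and $w_i^{(k)}=w_i^{(k-1)}$ for $i\ne i_k$. (3) $U_k=U_{k-1}+\frac1{n_X}\overline f'_{i_k}(\tilde\theta)\big(w^{(k)}_{i_k}-w^{(k-1)}_{i_k}\big)$. (4) sample, independently of $(i_k,j_k)$, $i'_k$ uniformly from $\{0,\dots,n_X-1\}$ and then $j'_k$ uniformly from $\{0,\dots,n_{Y_{i'_k}}-1\}$; set $\delta_k^\theta=f'_{\theta^{(k-1)}}(x_{i'_k},y_{i'_kj'_k})w^{(k)}_{i'_k}-f'_{\tilde\theta}(x_{i'_k},y_{i'_kj'_k})w^{(k)}_{i'_k}+U_k$. (5) $\theta^{(k)}=\arg\min_\theta\big[\langle\delta_k^\theta,\theta\rangle+g(\theta)+\frac1{2\alpha_\theta}\|\theta-\theta^{(k-1)}\|^2\big]$.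 End of stage, Option I: $\tilde w_s=w^{(M)}$ and $\tilde\theta_s=\theta^{(M)}$. All sampling is independent across iterations and stages; $\mathsf{E}$ is expectation over all sampling. Cost. One oracle call is one query of $f_\theta$, $f'_\theta$ or $\phi_i(u)$; the minimizations in steps (2) and (5) are regarded as solvable in closed form, so each inner iteration costs $O(1)$ oracle calls. The $O(\cdot)$ hides absolute constants, and $P_0$ is treated as a constant. *)

theory Defs
  imports "HOL-Probability.Probability"
begin

section \<open>Convex analysis\<close>

definition grad :: "('a::real_inner \<Rightarrow> real) \<Rightarrow> 'a \<Rightarrow> 'a" where
  "grad h u = (THE D. GDERIV h u :> D)"

definition convex_conjugate :: "('a::real_inner \<Rightarrow> real) \<Rightarrow> 'a \<Rightarrow> ereal" where
  "convex_conjugate h w = (SUP u. ereal (u \<bullet> w - h u))"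

definition strongly_convex :: "real \<Rightarrow> ('a::real_inner \<Rightarrow> real) \<Rightarrow> bool" where
  "strongly_convex m h \<longleftrightarrow>
     (\<forall>u v. \<forall>t\<in>{0..1}. h ((1 - t) *\<^sub>R u + t *\<^sub>R v)
        \<le> (1 - t) * h u + t * h v - m / 2 * t * (1 - t) * (norm (u - v))\<^sup>2)"

definition smooth_function :: "real \<Rightarrow> ('a::real_inner \<Rightarrow> real) \<Rightarrow> bool" where
  "smooth_function c h \<longleftrightarrow> (\<forall>u. h differentiable (at u)) \<and> c-lipschitz_on UNIV (grad h)"

section \<open>The composition problem\<close>

text \<open>
  The data are \<open>x i\<close>, \<open>y i j\<close> for \<open>i < nX\<close>, \<open>j < nY i\<close>. A dual variable in the
  product of \<open>nX\<close> copies of \<open>real^'l\<close> is a function \<open>w\<close> on \<open>nat\<close> of which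
  only the values at \<open>i < nX\<close> are ever used.
\<close>

text \<open>
  The library Jacobian has rows indexed by the components of \<open>f\<close>; here rows are indexed
  by the components of the parameter, so it is transposed.
\<close>

definition fprime ::
  "(real^'d \<Rightarrow> real^'mx \<Rightarrow> real^'my \<Rightarrow> real^'l) \<Rightarrow> real^'d \<Rightarrow> real^'mx \<Rightarrow> real^'my \<Rightarrow> real^'l^'d" where
  "fprime f \<theta> a b = transpose (jacobian (\<lambda>\<eta>. f \<eta> a b) (at \<theta>))"

definition fbar ::
  "(nat \<Rightarrow> nat) \<Rightarrow> (nat \<Rightarrow> real^'mx) \<Rightarrow> (nat \<Rightarrow> nat \<Rightarrow> real^'my) \<Rightarrow>
   (real^'d \<Rightarrow> real^'mx \<Rightarrow> real^'my \<Rightarrow> real^'l) \<Rightarrow> real^'d \<Rightarrow> nat \<Rightarrow> real^'l" where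
  "fbar nY x y f \<theta> i = (1 / real (nY i)) *\<^sub>R (\<Sum>j<nY i. f \<theta> (x i) (y i j))"

definition fbar_prime ::
  "(nat \<Rightarrow> nat) \<Rightarrow> (nat \<Rightarrow> real^'mx) \<Rightarrow> (nat \<Rightarrow> nat \<Rightarrow> real^'my) \<Rightarrow>
   (real^'d \<Rightarrow> real^'mx \<Rightarrow> real^'my \<Rightarrow> real^'l) \<Rightarrow> real^'d \<Rightarrow> nat \<Rightarrow> real^'l^'d" where
  "fbar_prime nY x y f \<theta> i = (1 / real (nY i)) *\<^sub>R (\<Sum>j<nY i. fprime f \<theta> (x i) (y i j))"

text \<open>
  The conjugate of a real-valued function never takes the value \<open>-\<infinity>\<close>, so every summand
  below is less than \<open>\<infinity>\<close> and the extended real sum is the usual one: finite if every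
  conjugate is finite at \<open>w\<close>, and \<open>-\<infinity>\<close> otherwise.
\<close>

definition lagrangian ::
  "nat \<Rightarrow> (nat \<Rightarrow> nat) \<Rightarrow> (nat \<Rightarrow> real^'mx) \<Rightarrow> (nat \<Rightarrow> nat \<Rightarrow> real^'my) \<Rightarrow>
   (real^'d \<Rightarrow> real^'mx \<Rightarrow> real^'my \<Rightarrow> real^'l) \<Rightarrow> (nat \<Rightarrow> real^'l \<Rightarrow> real) \<Rightarrow>
   real^'d \<Rightarrow> (nat \<Rightarrow> real^'l) \<Rightarrow> ereal" where
  "lagrangian nX nY x y f \<phi> \<theta> w =
     ereal (1 / real nX) *
       (\<Sum>i<nX. ereal (fbar nY x y f \<theta> i \<bullet> w i) - convex_conjugate (\<phi> i) (w i))"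

definition saddle_point ::
  "nat \<Rightarrow> (nat \<Rightarrow> nat) \<Rightarrow> (nat \<Rightarrow> real^'mx) \<Rightarrow> (nat \<Rightarrow> nat \<Rightarrow> real^'my) \<Rightarrow>
   (real^'d \<Rightarrow> real^'mx \<Rightarrow> real^'my \<Rightarrow> real^'l) \<Rightarrow> (nat \<Rightarrow> real^'l \<Rightarrow> real) \<Rightarrow> (real^'d \<Rightarrow> real) \<Rightarrow>
   real^'d \<Rightarrow> (nat \<Rightarrow> real^'l) \<Rightarrow> bool" where
  "saddle_point nX nY x y f \<phi> g \<theta>s ws \<longleftrightarrow>
     is_arg_min (\<lambda>\<theta>. lagrangian nX nY x y f \<phi> \<theta> ws + ereal (g \<theta>)) (\<lambda>_. True) \<theta>s \<and>
     (\<forall>i<nX. is_arg_min (\<lambda>v. convex_conjugate (\<phi> i) v - ereal (fbar nY x y f \<theta>s i \<bullet> v))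
                (\<lambda>_. True) (ws i))"

section \<open>The algorithm\<close>

text \<open>
  Running a Markov kernel \<open>K\<close> for \<open>k\<close> steps; since the state is passed on through
  \<open>bind_pmf\<close>, the draws made in different steps are independent.
\<close>

primrec iterate_pmf :: "('s \<Rightarrow> 's pmf) \<Rightarrow> nat \<Rightarrow> 's \<Rightarrow> 's pmf" where
  "iterate_pmf K 0 st = return_pmf st"
| "iterate_pmf K (Suc k) st = bind_pmf (iterate_pmf K k st) K"

definition sample_index :: "nat \<Rightarrow> (nat \<Rightarrow> nat) \<Rightarrow> (nat \<times> nat) pmf" where
  "sample_index nX nY = do {
     i \<leftarrow> pmf_of_set {..<nX};
     j \<leftarrow> pmf_of_set {..<nY i};
     return_pmf (i, j)
   }"

text \<open>
  One inner iteration, with reference point \<open>\<theta>t\<close>. The state is \<open>(\<theta>, w, U, q)\<close>, where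
  \<open>q\<close> counts oracle calls. The averages \<open>fbar\<close> and \<open>fbar_prime\<close> at \<open>\<theta>t\<close> are
  computed once per stage and cost nothing here. What remains are two calls of \<open>f\<close>, two
  of \<open>fprime\<close>, and one call charged to \<open>\<phi> i\<close> in the minimization over \<open>v\<close>.
\<close>

definition svrpda_step ::
  "nat \<Rightarrow> (nat \<Rightarrow> nat) \<Rightarrow> (nat \<Rightarrow> real^'mx) \<Rightarrow> (nat \<Rightarrow> nat \<Rightarrow> real^'my) \<Rightarrow>
   (real^'d \<Rightarrow> real^'mx \<Rightarrow> real^'my \<Rightarrow> real^'l) \<Rightarrow> (nat \<Rightarrow> real^'l \<Rightarrow> real) \<Rightarrow> (real^'d \<Rightarrow> real) \<Rightarrow>
   real \<Rightarrow> real \<Rightarrow> real^'d \<Rightarrow>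
   (real^'d) \<times> (nat \<Rightarrow> real^'l) \<times> (real^'d) \<times> nat \<Rightarrow>
   ((real^'d) \<times> (nat \<Rightarrow> real^'l) \<times> (real^'d) \<times> nat) pmf" where
  "svrpda_step nX nY x y f \<phi> g \<alpha>\<theta> \<alpha>w \<theta>t = (\<lambda>(\<theta>, w, U, q). do {
     (i, j) \<leftarrow> sample_index nX nY;
     let \<delta>w = f \<theta> (x i) (y i j) - f \<theta>t (x i) (y i j) + fbar nY x y f \<theta>t i;
     let w' = w(i := arg_min
           (\<lambda>v. ereal (- (\<delta>w \<bullet> v)) + convex_conjugate (\<phi> i) v
                 + ereal (1 / (2 * \<alpha>w) * (norm (v - w i))\<^sup>2)) (\<lambda>_. True));
     let U' = U + (1 / real nX) *\<^sub>R (fbar_prime nY x y f \<theta>t i *v (w' i - w i));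
     (i', j') \<leftarrow> sample_index nX nY;
     let \<delta>\<theta> = fprime f \<theta> (x i') (y i' j') *v w' i' - fprime f \<theta>t (x i') (y i' j') *v w' i' + U';
     let \<theta>' = arg_min
           (\<lambda>\<eta>. \<delta>\<theta> \<bullet> \<eta> + g \<eta> + 1 / (2 * \<alpha>\<theta>) * (norm (\<eta> - \<theta>))\<^sup>2) (\<lambda>_. True);
     return_pmf (\<theta>', w', U', q + 5)
   })"

text \<open>
  One stage, with Option I. Its initial full pass calls \<open>f\<close> and \<open>fprime\<close> at \<open>\<theta>t\<close>
  once for each data point \<open>(x i, y i j)\<close>.
\<close>

definition svrpda_stage ::
  "nat \<Rightarrow> (nat \<Rightarrow> nat) \<Rightarrow> (nat \<Rightarrow> real^'mx) \<Rightarrow> (nat \<Rightarrow> nat \<Rightarrow> real^'my) \<Rightarrow>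
   (real^'d \<Rightarrow> real^'mx \<Rightarrow> real^'my \<Rightarrow> real^'l) \<Rightarrow> (nat \<Rightarrow> real^'l \<Rightarrow> real) \<Rightarrow> (real^'d \<Rightarrow> real) \<Rightarrow>
   real \<Rightarrow> real \<Rightarrow> nat \<Rightarrow>
   (real^'d) \<times> (nat \<Rightarrow> real^'l) \<times> nat \<Rightarrow> ((real^'d) \<times> (nat \<Rightarrow> real^'l) \<times> nat) pmf" where
  "svrpda_stage nX nY x y f \<phi> g \<alpha>\<theta> \<alpha>w M = (\<lambda>(\<theta>t, wt, q). do {
     let U0 = (\<Sum>i<nX. \<Sum>j<nY i.
           (1 / (real nX * real (nY i))) *\<^sub>R (fprime f \<theta>t (x i) (y i j) *v wt i));
     (\<theta>, w, U, q') \<leftarrow> iterate_pmf (svrpda_step nX nY x y f \<phi> g \<alpha>\<theta> \<alpha>w \<theta>t) M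
           (\<theta>t, wt, U0, q + 2 * (\<Sum>i<nX. nY i));
     return_pmf (\<theta>, w, q')
   })"

text \<open>
  The joint law of the iterates after \<open>s\<close> stages and of the number of oracle calls made.
\<close>

definition svrpda ::
  "nat \<Rightarrow> (nat \<Rightarrow> nat) \<Rightarrow> (nat \<Rightarrow> real^'mx) \<Rightarrow> (nat \<Rightarrow> nat \<Rightarrow> real^'my) \<Rightarrow>
   (real^'d \<Rightarrow> real^'mx \<Rightarrow> real^'my \<Rightarrow> real^'l) \<Rightarrow> (nat \<Rightarrow> real^'l \<Rightarrow> real) \<Rightarrow> (real^'d \<Rightarrow> real) \<Rightarrow>
   real \<Rightarrow> real \<Rightarrow> nat \<Rightarrow> real^'d \<Rightarrow> (nat \<Rightarrow> real^'l) \<Rightarrow> nat \<Rightarrow>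
   ((real^'d) \<times> (nat \<Rightarrow> real^'l) \<times> nat) pmf" where
  "svrpda nX nY x y f \<phi> g \<alpha>\<theta> \<alpha>w M \<theta>0 w0 s =
     iterate_pmf (svrpda_stage nX nY x y f \<phi> g \<alpha>\<theta> \<alpha>w M) s (\<theta>0, w0, 0)"

text \<open>
  The constant hidden in the complexity bound may depend on the initial value \<open>p\<close> of the
  Lyapunov function, but not on anything else in the problem. In particular it must be the same in
  all dimensions. These are type variables here, which an existential quantifier over the constant
  cannot precede, so an (unoptimized) explicit value is fixed. The logarithm accounts for the
  additional stages that reduce \<open>p\<close> to 1.
\<close>

definition oracle_const :: "real \<Rightarrow> real" where
  "oracle_const p = 2500 * (1 + max 0 (ln p))"

end

theory Submission
  imports Defs
begin

text \<open>
  Adding the proximal inequality of the dual step to that of the primal step, the bilinear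
  coupling terms cancel up to a product of the dual increment with \<open>fbar \<theta> - fbar \<theta>s\<close>, and the
  sampling noise of both steps is bounded by the squared distances of \<open>\<theta>\<close> and of the reference point
  to \<open>\<theta>s\<close>. The dual step needs only the cocoercivity of \<open>grad (\<phi> i)\<close>, since its result is
  \<open>grad (\<phi> i) p\<close> for \<open>p\<close> with \<open>grad (\<phi> i) p = w + \<alpha>w (\<delta> - p)\<close>. In expectation a weighted sum of squared
  distances contracts by \<open>1 - (3/5) / (n (64 \<kappa> + 1) + 1)\<close> per inner iteration, up to a multiple of the
  squared distance of the reference point, and \<open>M\<close> iterations bring this factor below \<open>1/2\<close>.

  The initial dual point may lie outside the domain of the conjugates, where neither the bound \<open>Bw\<close>
  nor the convexity of the Lagrangian is available. A coordinate enters the domain as soon as it is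
  sampled, so the squared distance carried by the coordinates outside decays in expectation by
  \<open>1 - 1 / n\<close> per iteration; it is added to the potential with a suitable weight.
\<close>

section \<open>Convex analysis\<close>

text \<open>The primal step uses the dual vector that has just been updated. The proximal
  inequalities dictate the weights: with the given step sizes,
  \<open>1 / (2 * \<alpha>w) + \<gamma>\<close> equals
  \<open>\<gamma> / 2 * (64 * \<kappa> + 3)\<close> and
  \<open>1 / (2 * \<alpha>\<theta>) + \<mu>\<close> is slightly above
  \<open>\<mu> / 2 * scale\<close>; the quotient of these two values is the dual weight of the
  Lyapunov function. The factor 64 in the step sizes keeps the coefficients of the squared primal
  errors below \<open>\<mu> / 64\<close>. Over a stage, the halved potential, the summed errors of
  the reference point and the passage between potential and Lyapunov function combine to the factor
  12/19, which is below 3/4.\<close>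

lemma GDERIV_unique:
  assumes "GDERIV h u :> D" "GDERIV h u :> D'" shows "D = D'"
proof -
  have "(\<lambda>v. v \<bullet> D) = (\<lambda>v. v \<bullet> D')"
    using assms unfolding gderiv_def by (rule has_derivative_unique)
  then show ?thesis by (metis inner_commute vector_eq_rdot inner_eq_zero_iff inner_diff_left right_minus_eq)
qed

lemma GDERIV_grad_eq: "GDERIV h u :> D \<Longrightarrow> grad h u = D"
  unfolding grad_def using GDERIV_unique by (intro the_equality) blast+

lemma GDERIV_grad:
  fixes h :: "'a::euclidean_space \<Rightarrow> real"
  assumes "h differentiable (at u)" shows "GDERIV h u :> grad h u"
proof -
  obtain h' where h': "(h has_derivative h') (at u)"
    using assms unfolding differentiable_def by blast
  then have "linear h'" by (rule has_derivative_linear)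
  then have "h' v = v \<bullet> adjoint h' 1" for v
    using adjoint_works[of h' v 1] by simp
  then have "GDERIV h u :> adjoint h' 1"
    using h' unfolding gderiv_def by (metis (no_types, lifting) ext)
  then show ?thesis using GDERIV_grad_eq by metis
qed

lemma GDERIV_line:
  assumes "GDERIV h (u + t *\<^sub>R d) :> D"
  shows "((\<lambda>s. h (u + s *\<^sub>R d)) has_real_derivative d \<bullet> D) (at t)"
proof -
  have "((\<lambda>s. u + s *\<^sub>R d) has_derivative (\<lambda>s. s *\<^sub>R d)) (at t)"
    by (auto intro!: derivative_eq_intros)
  from has_derivative_compose[OF this assms[unfolded gderiv_def]]
  show ?thesis unfolding has_field_derivative_def
    by (simp add: mult.commute[of _ "d \<bullet> D"] mult_commute_abs)
qed

text \<open>Restriction to the line through \<open>u\<close> and \<open>v\<close> reduces this to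
  the tangent inequality in one variable.\<close>

lemma convex_above_tangent:
  fixes h :: "'a::real_inner \<Rightarrow> real"
  assumes cvx: "convex_on UNIV h" and D: "GDERIV h u :> D"
  shows "h v \<ge> h u + (v - u) \<bullet> D"
proof -
  let ?k = "\<lambda>t. h (u + t *\<^sub>R (v - u))"
  have "convex_on UNIV ?k"
  proof (rule convex_onI)
    fix t a b :: real assume t: "0 < t" "t < 1"
    have "u + ((1 - t) *\<^sub>R a + t *\<^sub>R b) *\<^sub>R (v - u)
        = (1 - t) *\<^sub>R (u + a *\<^sub>R (v - u)) + t *\<^sub>R (u + b *\<^sub>R (v - u))"
      by (simp add: algebra_simps)
    then show "?k ((1 - t) *\<^sub>R a + t *\<^sub>R b) \<le> (1 - t) * ?k a + t * ?k b"
      using convex_onD[OF cvx, of t] t by auto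
  qed simp
  moreover have "(?k has_real_derivative (v - u) \<bullet> D) (at 0 within UNIV)"
    using GDERIV_line[of h u 0 "v - u" D] D by simp
  ultimately have "?k 1 - ?k 0 \<ge> (v - u) \<bullet> D * (1 - 0)"
    by (intro convex_on_imp_above_tangent[where A = UNIV]) auto
  then show ?thesis by simp
qed

text \<open>The gap between \<open>h\<close> and its quadratic model is nonincreasing along the
  segment from \<open>u\<close> to \<open>v\<close>: the Lipschitz bound on the gradient makes its
  derivative nonpositive.\<close>

lemma descent_lemma:
  fixes h :: "'a::euclidean_space \<Rightarrow> real"
  assumes "smooth_function c h"
  shows "h v \<le> h u + (v - u) \<bullet> grad h u + c / 2 * (norm (v - u))\<^sup>2"
proof -
  define d where "d = v - u"
  let ?k = "\<lambda>t. h (u + t *\<^sub>R d) - t * (d \<bullet> grad h u) - c / 2 * t\<^sup>2 * (norm d)\<^sup>2"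
  have D: "GDERIV h w :> grad h w" for w
    using assms GDERIV_grad unfolding smooth_function_def by blast
  have lip: "norm (grad h a - grad h b) \<le> c * norm (a - b)" for a b
    using assms unfolding smooth_function_def lipschitz_on_def dist_norm by blast
  have "?k 1 \<le> ?k 0"
  proof (rule DERIV_nonpos_imp_nonincreasing[where f = ?k])
    fix t :: real assume t: "0 \<le> t" "t \<le> 1"
    have "d \<bullet> (grad h (u + t *\<^sub>R d) - grad h u) \<le> norm d * norm (grad h (u + t *\<^sub>R d) - grad h u)"
      by (rule norm_cauchy_schwarz)
    also have "\<dots> \<le> norm d * (c * norm (t *\<^sub>R d))"
      using lip[of "u + t *\<^sub>R d" u] by (intro mult_left_mono) auto
    finally have "d \<bullet> grad h (u + t *\<^sub>R d) - d \<bullet> grad h u - c * t * (norm d)\<^sup>2 \<le> 0"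
      using t by (simp add: inner_diff_right power2_eq_square algebra_simps)
    moreover have "(?k has_real_derivative
        d \<bullet> grad h (u + t *\<^sub>R d) - d \<bullet> grad h u - c * t * (norm d)\<^sup>2) (at t)"
      by (auto intro!: derivative_eq_intros GDERIV_line D)
    ultimately show "\<exists>y. (?k has_real_derivative y) (at t) \<and> y \<le> 0" by blast
  qed simp
  then show ?thesis by (simp add: d_def)
qed

text \<open>Baillon--Haddad: apply convexity and the descent lemma at \<open>v - (1/c) (\<nabla>h v - \<nabla>h u)\<close>.\<close>

lemma grad_cocoercive:
  fixes h :: "'a::euclidean_space \<Rightarrow> real"
  assumes sm: "smooth_function c h" and cvx: "convex_on UNIV h" and c: "c > 0"
  shows "(grad h u - grad h v) \<bullet> (u - v) \<ge> 1 / c * (norm (grad h u - grad h v))\<^sup>2"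
proof -
  have D: "GDERIV h w :> grad h w" for w
    using sm GDERIV_grad unfolding smooth_function_def by blast
  have *: "h v \<ge> h u + (v - u) \<bullet> grad h u + 1 / (2 * c) * (norm (grad h v - grad h u))\<^sup>2" for u v
  proof -
    define e where "e = grad h v - grad h u"
    define z where "z = v - (1 / c) *\<^sub>R e"
    have "h u + (z - u) \<bullet> grad h u \<le> h z"
      by (rule convex_above_tangent[OF cvx D])
    also have "h z \<le> h v + (z - v) \<bullet> grad h v + c / 2 * (norm (z - v))\<^sup>2"
      by (rule descent_lemma[OF sm])
    finally have "h u + (z - u) \<bullet> grad h u \<le> h v + (z - v) \<bullet> grad h v + c / 2 * (norm (z - v))\<^sup>2" .
    moreover have "c / 2 * (norm (z - v))\<^sup>2 = 1 / (2 * c) * (norm e)\<^sup>2"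
      using c by (simp add: z_def power2_eq_square field_simps)
    moreover have "(z - u) \<bullet> grad h u - (z - v) \<bullet> grad h v = (v - u) \<bullet> grad h u + 1 / c * (norm e)\<^sup>2"
      by (simp add: z_def e_def power2_norm_eq_inner algebra_simps inner_commute)
    moreover have "1 / c * (norm e)\<^sup>2 = 2 * (1 / (2 * c) * (norm e)\<^sup>2)" by simp
    ultimately show ?thesis unfolding e_def[symmetric] by linarith
  qed
  show ?thesis using *[of u v] *[of v u] c
    by (simp add: norm_minus_commute inner_diff_left inner_diff_right inner_commute field_simps)
qed

section \<open>Conjugates, the Fenchel-Young inequality and existence of minimizers\<close>

lemma conjugate_ge: "convex_conjugate h w \<ge> ereal (u \<bullet> w - h u)"
  unfolding convex_conjugate_def by (rule SUP_upper) simp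

lemma conjugate_grad:
  fixes h :: "'a::euclidean_space \<Rightarrow> real"
  assumes "convex_on UNIV h" "GDERIV h u :> D"
  shows "convex_conjugate h D = ereal (u \<bullet> D - h u)"
proof (rule antisym)
  show "convex_conjugate h D \<le> ereal (u \<bullet> D - h u)"
    unfolding convex_conjugate_def
    using convex_above_tangent[OF assms] by (intro SUP_least) (simp add: inner_diff_left algebra_simps)
qed (rule conjugate_ge)

lemma GDERIV_min_zero:
  assumes "GDERIV h u :> D" "\<And>v. h u \<le> h v"
  shows "D = 0"
proof -
  have "((\<lambda>s. h (u + s *\<^sub>R D)) has_real_derivative D \<bullet> D) (at 0)"
    using GDERIV_line[of h u 0 D D] assms(1) by simp
  then have "D \<bullet> D = 0"
    by (rule DERIV_local_min[where d = 1]) (use assms(2) in auto)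
  then show ?thesis by simp
qed

text \<open>Comparison with \<open>D\<close>, where Fenchel-Young is an equality, forces equality at
  \<open>w\<close> as well. Hence \<open>u\<close> minimizes \<open>h v - v \<bullet> w\<close>,
  whose gradient at \<open>u\<close> is \<open>D - w\<close>. This turns the dual saddle condition
  into a gradient formula.\<close>

lemma conjugate_arg_min:
  fixes h :: "'a::euclidean_space \<Rightarrow> real"
  assumes cvx: "convex_on UNIV h" and D: "GDERIV h u :> D"
    and w: "is_arg_min (\<lambda>v. convex_conjugate h v - ereal (u \<bullet> v)) (\<lambda>_. True) w"
  shows "w = D"
proof -
  have "convex_conjugate h w - ereal (u \<bullet> w) \<le> ereal (- h u)"
    using w[unfolded is_arg_min_linorder, THEN conjunct2, rule_format, of D] conjugate_grad[OF cvx D] by simp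
  then have w_le: "convex_conjugate h w \<le> ereal (u \<bullet> w - h u)"
    by (cases "convex_conjugate h w") auto
  have min: "h u - u \<bullet> w \<le> h v - v \<bullet> w" for v
    using order_trans[OF conjugate_ge[of v w h] w_le] by simp
  have "GDERIV (\<lambda>v. v \<bullet> w) u :> w"
    unfolding gderiv_def by (auto intro!: derivative_eq_intros)
  from GDERIV_min_zero[OF GDERIV_diff[OF D this]] min show ?thesis by simp
qed

text \<open>Outside the ball of radius \<open>r\<close> the quadratic lower bound already exceeds
  \<open>h p\<close>, so the minimum over this compact ball is global.\<close>

lemma coercive_attains_min:
  fixes h :: "'a::euclidean_space \<Rightarrow> real"
  assumes cont: "continuous_on UNIV h" and c: "c > 0"
    and low: "\<And>v. h v \<ge> c * (norm (v - p))\<^sup>2 - b"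
  obtains u where "\<And>v. h u \<le> h v"
proof -
  \<comment> \<open>The library square root is negative at negative arguments; the maximum with 0
    keeps the ball nonempty.\<close>
  define r where "r = sqrt (max 0 ((h p + b) / c))"
  have "compact (cball p r)" "cball p r \<noteq> {}" by (auto simp: r_def)
  then obtain u where u: "u \<in> cball p r" "\<And>v. v \<in> cball p r \<Longrightarrow> h u \<le> h v"
    using continuous_attains_inf continuous_on_subset[OF cont] by (metis subset_UNIV)
  have "h u \<le> h v" for v
  proof (cases "v \<in> cball p r")
    case False
    then have "r\<^sup>2 < (norm (v - p))\<^sup>2"
      by (intro power_strict_mono) (auto simp: dist_norm norm_minus_commute r_def)
    then have "(h p + b) / c < (norm (v - p))\<^sup>2" by (simp add: r_def)
    then have "h p \<le> h v" using low[of v] c by (simp add: field_simps)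
    moreover have "h u \<le> h p" by (rule u) (simp add: r_def)
    ultimately show ?thesis by simp
  qed (use u in blast)
  then show thesis by (rule that)
qed

lemma norm_add_scaleR_sq:
  "(norm (u + c *\<^sub>R v))\<^sup>2 = (norm u)\<^sup>2 + 2 * c * (u \<bullet> v) + c\<^sup>2 * (norm v)\<^sup>2"
  unfolding power2_norm_eq_inner by (simp add: algebra_simps inner_commute power2_eq_square)

text \<open>The supremum is tested along the ray through \<open>w\<close>. If
  \<open>norm w > B\<close>, the linear term outgrows the Lipschitz bound on \<open>h\<close> at the
  rate \<open>norm w * (norm w - B)\<close>, and the conjugate is infinite.\<close>

lemma conjugate_finite_imp_bounded:
  fixes h :: "'a::real_inner \<Rightarrow> real"
  assumes lip: "\<And>u v. \<bar>h u - h v\<bar> \<le> B * norm (u - v)" and B: "B \<ge> 0"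
    and fin: "convex_conjugate h w < \<infinity>"
  shows "norm w \<le> B"
proof (rule ccontr)
  assume "\<not> norm w \<le> B"
  then have pos: "norm w * (norm w - B) > 0"
    using B by (intro mult_pos_pos) linarith+
  obtain b where b: "convex_conjugate h w = ereal b"
    using fin conjugate_ge[where h = h and w = w and u = 0] by (cases "convex_conjugate h w") auto
  have "t * (norm w * (norm w - B)) \<le> b + h 0" if "t \<ge> 0" for t
  proof -
    have "t * (w \<bullet> w) - h (t *\<^sub>R w) \<le> b"
      using conjugate_ge[of "t *\<^sub>R w" w h] b by simp
    moreover have "h (t *\<^sub>R w) \<le> h 0 + B * (t * norm w)"
      using lip[of "t *\<^sub>R w" 0] that by simp
    ultimately show ?thesis by (simp add: algebra_simps power2_eq_square flip: power2_norm_eq_inner)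
  qed
  \<comment> \<open>This \<open>t\<close> makes the left side
    \<open>\<bar>b + h 0\<bar> + 1\<close>, which the right side cannot reach.\<close>
  from this[of "(\<bar>b + h 0\<bar> + 1) / (norm w * (norm w - B))"]
  have "\<bar>b + h 0\<bar> + 1 \<le> b + h 0"
    using pos less_imp_neq[OF pos, symmetric]
    by (simp only: times_divide_eq_left nonzero_mult_div_cancel_right) simp
  then show False by linarith
qed

text \<open>
  The proximal step on the conjugate is solved through the dual minimization over \<open>p\<close>, which
  involves only the finite function \<open>h\<close>.
\<close>

lemma conjugate_prox:
  fixes h :: "'a::euclidean_space \<Rightarrow> real"
  assumes cvx: "convex_on UNIV h" and diff: "\<And>u. h differentiable (at u)"
    and nonneg: "\<And>u. h u \<ge> 0" and a: "a > 0"
  obtains p where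
    "arg_min (\<lambda>v. ereal (- (\<delta> \<bullet> v)) + convex_conjugate h v
        + ereal (1 / (2 * a) * (norm (v - w))\<^sup>2)) (\<lambda>_. True) = grad h p"
    "grad h p = w + a *\<^sub>R (\<delta> - p)"
proof -
  \<comment> \<open>The Fenchel dual of the proximal problem becomes, after completing the square,
    the minimization of \<open>h v + a / 2 * (norm (v - q))\<^sup>2\<close>.\<close>
  define q where "q = \<delta> + (1 / a) *\<^sub>R w"
  have D: "GDERIV h u :> grad h u" for u using GDERIV_grad diff by blast
  have "continuous_on UNIV h"
    by (intro continuous_at_imp_continuous_on ballI differentiable_imp_continuous_within diff)
  then have "continuous_on UNIV (\<lambda>v. h v + a / 2 * (norm (v - q))\<^sup>2)"
    by (intro continuous_intros)
  then obtain p where p: "h p + a / 2 * (norm (p - q))\<^sup>2 \<le> h v + a / 2 * (norm (v - q))\<^sup>2" for v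
    using a nonneg coercive_attains_min[where p = q and c = "a / 2" and b = 0
        and h = "\<lambda>v. h v + a / 2 * (norm (v - q))\<^sup>2"] by auto
  have "GDERIV (\<lambda>v. a / 2 * (norm (v - q))\<^sup>2) p :> a *\<^sub>R (p - q)"
    unfolding gderiv_def power2_norm_eq_inner
    by (auto intro!: derivative_eq_intros simp: inner_commute algebra_simps)
  from GDERIV_min_zero[OF GDERIV_add[OF D this]] p have "grad h p + a *\<^sub>R (p - q) = 0" by blast
  then have v0: "grad h p = w + a *\<^sub>R (\<delta> - p)"
    using a by (simp add: q_def algebra_simps eq_neg_iff_add_eq_0)
  define H where "H = (\<lambda>v. ereal (- (\<delta> \<bullet> v)) + convex_conjugate h v
        + ereal (1 / (2 * a) * (norm (v - w))\<^sup>2))"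
  define z where "z = grad h p"
  have Hz: "H z = ereal (- (\<delta> \<bullet> z) + (p \<bullet> z - h p) + 1 / (2 * a) * (norm (z - w))\<^sup>2)"
    using conjugate_grad[OF cvx D, of p] by (simp add: H_def z_def)
  \<comment> \<open>Fenchel-Young at \<open>p\<close>, an equality at \<open>z\<close>, leaves this
    quadratic remainder. It makes \<open>z\<close> the only minimizer, so \<open>arg_min\<close> can
    choose nothing else.\<close>
  have ge: "H v \<ge> H z + ereal (1 / (2 * a) * (norm (v - z))\<^sup>2)" for v
  proof -
    have w: "w = z - a *\<^sub>R (\<delta> - p)" using v0 by (simp add: z_def)
    have "(norm (v - w))\<^sup>2 = (norm (v - z))\<^sup>2 + 2 * a * ((v - z) \<bullet> (\<delta> - p)) + (norm (z - w))\<^sup>2"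
      unfolding w power2_norm_eq_inner by (simp add: algebra_simps inner_commute)
    then have "1 / (2 * a) * (norm (v - w))\<^sup>2
        = 1 / (2 * a) * (norm (v - z))\<^sup>2 + (v - z) \<bullet> (\<delta> - p) + 1 / (2 * a) * (norm (z - w))\<^sup>2"
      using a by (simp add: field_simps)
    then have "- (\<delta> \<bullet> z) + (p \<bullet> z - h p) + 1 / (2 * a) * (norm (z - w))\<^sup>2 + 1 / (2 * a) * (norm (v - z))\<^sup>2
        = - (\<delta> \<bullet> v) + (p \<bullet> v - h p) + 1 / (2 * a) * (norm (v - w))\<^sup>2"
      by (simp add: inner_diff_left inner_diff_right inner_commute)
    then show ?thesis
      using conjugate_ge[of p v h] unfolding Hz by (cases "convex_conjugate h v") (auto simp: H_def)
  qed
  have "H z \<le> H v" for v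
  proof -
    have "H z \<le> H z + ereal (1 / (2 * a) * (norm (v - z))\<^sup>2)"
      using a by (simp add: Hz)
    also have "\<dots> \<le> H v" by (rule ge)
    finally show ?thesis .
  qed
  then have "H (arg_min H (\<lambda>_. True)) = H z"
    by (intro arg_min_equality) auto
  with ge[of "arg_min H (\<lambda>_. True)"] have "1 / (2 * a) * (norm (arg_min H (\<lambda>_. True) - z))\<^sup>2 \<le> 0"
    by (simp add: Hz)
  then have "(norm (arg_min H (\<lambda>_. True) - z))\<^sup>2 \<le> 0"
    using a by (simp add: divide_le_0_iff)
  then have "arg_min H (\<lambda>_. True) = z" by simp
  then show thesis using that v0 unfolding H_def z_def by blast
qed

text \<open>The optimality equation \<open>w'\<close> expresses \<open>p - u\<close> through
  \<open>\<delta> - u\<close> and the increment \<open>grad h p - w\<close>. After pairing with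
  \<open>grad h p - grad h u\<close>, cocoercivity yields the term with \<open>c\<close> and
  polarization the three squared norms.\<close>

lemma conjugate_prox_step:
  fixes h :: "'a::euclidean_space \<Rightarrow> real"
  assumes "smooth_function (1 / c) h" "convex_on UNIV h" "c > 0" "a > 0"
    and w': "grad h p = w + a *\<^sub>R (\<delta> - p)"
  shows "(1 / (2 * a)) * ((norm (grad h p - grad h u))\<^sup>2 + (norm (grad h p - w))\<^sup>2 - (norm (w - grad h u))\<^sup>2)
      + c * (norm (grad h p - grad h u))\<^sup>2 \<le> (grad h p - grad h u) \<bullet> (\<delta> - u)"
proof -
  define z where "z = grad h p"
  have two: "2 * ((z - grad h u) \<bullet> (z - w)) = (norm (z - grad h u))\<^sup>2 + (norm (z - w))\<^sup>2 - (norm (w - grad h u))\<^sup>2"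
    unfolding power2_norm_eq_inner by (simp add: algebra_simps inner_commute)
  have "c * (norm (z - grad h u))\<^sup>2 \<le> (z - grad h u) \<bullet> (p - u)"
    using grad_cocoercive[OF assms(1,2), of p u] \<open>c > 0\<close> by (simp add: z_def)
  moreover have "p - u = (\<delta> - u) - (1 / a) *\<^sub>R (z - w)"
    using w' \<open>a > 0\<close> by (simp add: z_def)
  ultimately have "c * (norm (z - grad h u))\<^sup>2
      \<le> (z - grad h u) \<bullet> (\<delta> - u) - (1 / a) * ((z - grad h u) \<bullet> (z - w))"
    by (simp add: inner_diff_right[of _ "\<delta> - u"])
  moreover have "(1 / (2 * a)) * (2 * ((z - grad h u) \<bullet> (z - w))) = (1 / a) * ((z - grad h u) \<bullet> (z - w))"
    by simp
  ultimately show ?thesis unfolding z_def[symmetric] two[symmetric] by linarith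
qed

text \<open>First-order optimality for a sum in which \<open>g\<close> may lack a derivative. On the
  segment from \<open>u\<close> to \<open>v\<close>, \<open>k\<close> bounds
  \<open>h + g - g u\<close> from above, with equality at 0; if the claim failed, \<open>k\<close>
  would have a negative derivative at 0 and \<open>u\<close> would not be minimal.\<close>

lemma strongly_convex_min_ineq:
  assumes sc: "strongly_convex m g" and D: "GDERIV h u :> D"
    and min: "\<And>v. h u + g u \<le> h v + g v"
  shows "g v \<ge> g u - (v - u) \<bullet> D + m / 2 * (norm (v - u))\<^sup>2"
proof (rule ccontr)
  assume neg: "\<not> ?thesis"
  define k where "k t = h (u + t *\<^sub>R (v - u)) + t * (g v - g u) - m / 2 * t * (1 - t) * (norm (v - u))\<^sup>2" for t
  have "(k has_real_derivative (v - u) \<bullet> D + (g v - g u) - m / 2 * (norm (v - u))\<^sup>2) (at 0)"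
    unfolding k_def using D by (auto intro!: derivative_eq_intros GDERIV_line)
  then obtain d where d: "d > 0" "\<And>t. 0 < t \<Longrightarrow> t < d \<Longrightarrow> k (0 + t) < k 0"
    using DERIV_neg_dec_right neg by (smt (verit))
  define t where "t = min (d / 2) (1 / 2)"
  have t: "0 < t" "t < d" "t \<le> 1" using d(1) by (auto simp: t_def)
  have "g (u + t *\<^sub>R (v - u)) \<le> (1 - t) * g u + t * g v - m / 2 * t * (1 - t) * (norm (v - u))\<^sup>2"
    using sc[unfolded strongly_convex_def, rule_format, of t u v] t
    by (simp add: algebra_simps norm_minus_commute)
  then have "k t \<ge> k 0"
    using min[of "u + t *\<^sub>R (v - u)"] by (simp add: k_def algebra_simps)
  then show False using d(2)[of t] t by simp
qed

text \<open>The modulus counts twice, as \<open>m / 2\<close> from the minimality of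
  \<open>z\<close> and as \<open>m / 2\<close> from \<open>sub\<close>, which is strong convexity
  with the subgradient \<open>- D\<close> at \<open>u\<close>.\<close>

lemma prox_step:
  fixes g :: "'a::euclidean_space \<Rightarrow> real"
  assumes sc: "strongly_convex m g" and cvx: "convex_on UNIV g" and a: "a > 0" and m: "m > 0"
    and sub: "\<And>v. g v \<ge> g u - (v - u) \<bullet> D + m / 2 * (norm (v - u))\<^sup>2"
    and z: "z = arg_min (\<lambda>v. \<delta> \<bullet> v + g v + 1 / (2 * a) * (norm (v - x))\<^sup>2) (\<lambda>_. True)"
  shows "(1 / (2 * a)) * ((norm (z - u))\<^sup>2 + (norm (z - x))\<^sup>2 - (norm (x - u))\<^sup>2)
      + m * (norm (z - u))\<^sup>2 \<le> (u - z) \<bullet> (\<delta> - D)"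
proof -
  let ?H = "\<lambda>v. \<delta> \<bullet> v + g v + 1 / (2 * a) * (norm (v - x))\<^sup>2"
  have cont: "continuous_on UNIV ?H"
    using convex_on_continuous[OF open_UNIV cvx] by (intro continuous_intros)
  \<comment> \<open>Half of the proximal quadratic absorbs the linear lower bound on
    \<open>g\<close> coming from \<open>sub\<close>. The other half makes \<open>?H\<close>
    coercive, so that \<open>arg_min\<close> is attained.\<close>
  have low: "?H v \<ge> 1 / (4 * a) * (norm (v - x))\<^sup>2
      - (a * (norm (\<delta> - D))\<^sup>2 - (g u + u \<bullet> D + x \<bullet> (\<delta> - D)))" for v
  proof -
    have "0 \<le> 1 / (4 * a) * (norm ((v - x) + (2 * a) *\<^sub>R (\<delta> - D)))\<^sup>2" using a by simp
    also have "\<dots> = 1 / (4 * a) * (norm (v - x))\<^sup>2 + (v - x) \<bullet> (\<delta> - D) + a * (norm (\<delta> - D))\<^sup>2"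
      using a unfolding norm_add_scaleR_sq by (simp add: field_simps power2_eq_square)
    moreover have "g v \<ge> g u - (v - u) \<bullet> D" using sub[of v] m by (smt (verit) mult_nonneg_nonneg divide_nonneg_pos zero_le_power2)
    moreover have "1 / (2 * a) * (norm (v - x))\<^sup>2 = 2 * (1 / (4 * a) * (norm (v - x))\<^sup>2)" by simp
    ultimately show ?thesis
      by (simp add: inner_diff_left inner_diff_right inner_commute algebra_simps)
  qed
  obtain z0 where "\<And>v. ?H z0 \<le> ?H v"
    using coercive_attains_min[OF cont _ low] a by auto
  then have "?H z = ?H z0" unfolding z by (intro arg_min_equality) auto
  then have min: "?H z \<le> ?H v" for v using \<open>\<And>v. ?H z0 \<le> ?H v\<close> by simp
  have "GDERIV (\<lambda>v. \<delta> \<bullet> v + 1 / (2 * a) * (norm (v - x))\<^sup>2) z :> \<delta> + (1 / a) *\<^sub>R (z - x)"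
    using a unfolding gderiv_def power2_norm_eq_inner
    by (auto intro!: derivative_eq_intros simp: inner_commute algebra_simps)
  from strongly_convex_min_ineq[OF sc this, of u] min
  have "g u \<ge> g z - (u - z) \<bullet> (\<delta> + (1 / a) *\<^sub>R (z - x)) + m / 2 * (norm (u - z))\<^sup>2"
    by (simp add: algebra_simps)
  with sub[of z] have "(z - u) \<bullet> (\<delta> - D) + (1 / a) * ((z - u) \<bullet> (z - x)) + m * (norm (z - u))\<^sup>2 \<le> 0"
    by (simp add: norm_minus_commute algebra_simps inner_diff_left inner_diff_right)
  moreover have "(1 / (2 * a)) * ((norm (z - u))\<^sup>2 + (norm (z - x))\<^sup>2 - (norm (x - u))\<^sup>2)
      = (1 / a) * ((z - u) \<bullet> (z - x))"
    unfolding power2_norm_eq_inner using a by (simp add: field_simps inner_commute algebra_simps)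
  ultimately show ?thesis by (simp add: inner_diff_left)
qed

section \<open>Gradients and Lipschitz bounds from the transposed Jacobian\<close>

lemma GDERIV_inner_fprime:
  fixes f :: "real^'d \<Rightarrow> real^'mx \<Rightarrow> real^'my \<Rightarrow> real^'l"
  assumes "(\<lambda>\<eta>. f \<eta> a b) differentiable (at \<theta>)"
  shows "GDERIV (\<lambda>\<eta>. f \<eta> a b \<bullet> v) \<theta> :> fprime f \<theta> a b *v v"
proof -
  have "((\<lambda>\<eta>. f \<eta> a b) has_derivative (*v) (jacobian (\<lambda>\<eta>. f \<eta> a b) (at \<theta>))) (at \<theta>)"
    using assms by (simp add: jacobian_works)
  from has_derivative_inner_left[OF this, of v] show ?thesis
    unfolding gderiv_def fprime_def
    by (simp add: transpose_matrix_vector inner_commute[of _ v] inner_commute[of _ "v v* _"] dot_lmul_matrix)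
qed

text \<open>A matrix and its transpose have the same operator norm; only the direction needed here
  is shown, by pairing \<open>?y\<close> with itself. The mean value inequality then applies to the
  Jacobian.\<close>

lemma fprime_bound_imp_lipschitz:
  fixes f :: "real^'d \<Rightarrow> real^'mx \<Rightarrow> real^'my \<Rightarrow> real^'l"
  assumes diff: "\<And>\<theta>. (\<lambda>\<eta>. f \<eta> a b) differentiable (at \<theta>)"
    and bd: "\<And>\<theta>. onorm (\<lambda>v. fprime f \<theta> a b *v v) \<le> B"
  shows "norm (f \<theta>1 a b - f \<theta>2 a b) \<le> B * norm (\<theta>1 - \<theta>2)"
proof (rule differentiable_bound[where S = UNIV])
  fix \<theta> :: "real^'d"
  let ?J = "jacobian (\<lambda>\<eta>. f \<eta> a b) (at \<theta>)"
  show "((\<lambda>\<eta>. f \<eta> a b) has_derivative (*v) ?J) (at \<theta> within UNIV)"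
    using diff by (simp add: jacobian_works)
  show "onorm ((*v) ?J) \<le> B"
  proof (rule onorm_le)
    fix h
    let ?y = "?J *v h"
    have "norm ?y * norm ?y = h \<bullet> (fprime f \<theta> a b *v ?y)"
      by (simp add: fprime_def transpose_matrix_vector inner_commute[of h] dot_lmul_matrix
          flip: power2_norm_eq_inner power2_eq_square)
    also have "\<dots> \<le> norm h * norm (fprime f \<theta> a b *v ?y)" by (rule norm_cauchy_schwarz)
    also have "\<dots> \<le> norm h * (B * norm ?y)"
      using order_trans[OF onorm[OF matrix_vector_mul_bounded_linear] mult_right_mono[OF bd norm_ge_zero]]
      by (intro mult_left_mono) auto
    finally show "norm ?y \<le> B * norm h"
      by (cases "?y = 0") (use order_trans[OF onorm_pos_le[OF matrix_vector_mul_bounded_linear] bd] in \<open>auto simp: mult.commute\<close>)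
  qed
qed auto

section \<open>Averages\<close>

definition mean :: "nat \<Rightarrow> (nat \<Rightarrow> 'v::real_vector) \<Rightarrow> 'v" where
  "mean m X = (1 / real m) *\<^sub>R (\<Sum>i<m. X i)"

lemma mean_cong: "(\<And>i. i < m \<Longrightarrow> X i = Y i) \<Longrightarrow> mean m X = mean m Y"
  unfolding mean_def by simp

lemma mean_add: "mean m (\<lambda>i. X i + Y i) = mean m X + mean m Y"
  unfolding mean_def by (simp add: sum.distrib scaleR_add_right)

lemma mean_diff: "mean m (\<lambda>i. X i - Y i) = mean m X - mean m Y"
  unfolding mean_def by (simp add: sum_subtractf scaleR_diff_right)

lemma mean_const: "m \<ge> 1 \<Longrightarrow> mean m (\<lambda>_. c) = c"
  unfolding mean_def by (simp add: sum_constant_scaleR)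

lemma mean_mult_left: "mean m (\<lambda>i. c * X i) = c * mean m X" for c :: real
  unfolding mean_def by (simp add: sum_distrib_left mult.left_commute)

lemma mean_inner_left: "mean m (\<lambda>i. X i \<bullet> c) = mean m X \<bullet> c"
  unfolding mean_def by (simp add: inner_sum_left)

lemma mean_inner_right: "mean m (\<lambda>i. c \<bullet> X i) = c \<bullet> mean m X"
  unfolding mean_def by (simp add: inner_sum_right)

lemma mean_mono: "(\<And>i. i < m \<Longrightarrow> X i \<le> Y i) \<Longrightarrow> mean m X \<le> mean m Y" for X :: "nat \<Rightarrow> real"
  unfolding mean_def by (auto intro!: divide_right_mono sum_mono)

lemma mean_le: "m \<ge> 1 \<Longrightarrow> (\<And>i. i < m \<Longrightarrow> X i \<le> c) \<Longrightarrow> mean m X \<le> c" for X :: "nat \<Rightarrow> real"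
  using mean_mono[of m X "\<lambda>_. c"] by (simp add: mean_const)

lemma mean_norm_add_sq:
  fixes X :: "nat \<Rightarrow> 'v::real_inner"
  assumes "m \<ge> 1"
  shows "mean m (\<lambda>i. (norm (X i + c))\<^sup>2) = mean m (\<lambda>i. (norm (X i))\<^sup>2) + 2 * (mean m X \<bullet> c) + (norm c)\<^sup>2"
proof -
  have "(norm (X i + c))\<^sup>2 = (norm (X i))\<^sup>2 + 2 * (X i \<bullet> c) + (norm c)\<^sup>2" for i
    using norm_add_scaleR_sq[of "X i" 1 c] by simp
  then show ?thesis
    using assms by (simp add: mean_add mean_mult_left mean_inner_left mean_const)
qed

lemma norm_add_sq_le:
  fixes u v :: "'v::real_inner"
  shows "(norm (u + v))\<^sup>2 \<le> 2 * (norm u)\<^sup>2 + 2 * (norm v)\<^sup>2"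
proof -
  have "(norm (u + v))\<^sup>2 + (norm (u - v))\<^sup>2 = 2 * (norm u)\<^sup>2 + 2 * (norm v)\<^sup>2"
    using norm_add_scaleR_sq[of u 1 v] norm_add_scaleR_sq[of u "-1" v] by simp
  then show ?thesis by (smt (verit) zero_le_power2)
qed

lemma inner_le_weighted_sq:
  fixes u v :: "'c::real_inner"
  assumes "c > 0" shows "u \<bullet> v \<le> 1 / (2 * c) * (norm u)\<^sup>2 + c / 2 * (norm v)\<^sup>2"
proof -
  have "0 \<le> 1 / (2 * c) * (norm (u + (- c) *\<^sub>R v))\<^sup>2" using assms by simp
  also have "\<dots> = 1 / (2 * c) * (norm u)\<^sup>2 + c / 2 * (norm v)\<^sup>2 - u \<bullet> v"
    using assms unfolding norm_add_scaleR_sq by (simp add: field_simps power2_eq_square)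
  finally show ?thesis by simp
qed

lemma norm_center_sq_le: "2 * (m \<bullet> (c - m)) + (norm (c - m))\<^sup>2 \<le> (norm c)\<^sup>2"
proof -
  have "2 * (m \<bullet> (c - m)) + (norm (c - m))\<^sup>2 = (norm c)\<^sup>2 - (norm m)\<^sup>2"
    unfolding power2_norm_eq_inner by (simp add: algebra_simps inner_commute)
  then show ?thesis by simp
qed

text \<open>Centering removes the cross term with \<open>c\<close>, and the variance is at most the
  second moment.\<close>

lemma mean_norm_center_sq_le:
  fixes X :: "nat \<Rightarrow> 'v::real_inner"
  assumes "m \<ge> 1"
  shows "mean m (\<lambda>i. (norm (X i - mean m X + c))\<^sup>2) \<le> mean m (\<lambda>i. (norm (X i))\<^sup>2) + (norm c)\<^sup>2"
  using mean_norm_add_sq[OF assms, of X "c - mean m X"] norm_center_sq_le[of "mean m X" c]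
  by (simp add: algebra_simps)

lemma sum_fun_upd:
  fixes h :: "nat \<Rightarrow> 'b \<Rightarrow> 'c::ab_group_add" and i n :: nat
  assumes "i < n"
  shows "(\<Sum>l<n. h l ((w(i := z)) l)) = (\<Sum>l<n. h l (w l)) - h i (w i) + h i z"
proof -
  have "(\<Sum>l\<in>{..<n} - {i}. h l ((w(i := z)) l)) = (\<Sum>l\<in>{..<n} - {i}. h l (w l))"
    by (intro sum.cong) auto
  then show ?thesis
    using assms by (simp add: sum.remove[of "{..<n}" i])
qed

section \<open>One inner iteration\<close>

text \<open>\<open>J i j \<theta>\<close> stands for the transposed Jacobian as an action on dual
  vectors, which keeps matrices out of the analysis of a step.\<close>

locale composition_data =
  fixes n :: nat and nY :: "nat \<Rightarrow> nat"
    and F :: "nat \<Rightarrow> nat \<Rightarrow> 'a::real_inner \<Rightarrow> 'b::real_inner"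
    and J :: "nat \<Rightarrow> nat \<Rightarrow> 'a \<Rightarrow> 'b \<Rightarrow> 'a"
  assumes n: "n \<ge> 1" and nY: "\<And>i. i < n \<Longrightarrow> nY i \<ge> 1"
begin

text \<open>Expectation under two-stage sampling: every row has weight \<open>1 / n\<close>,
  whatever its length.\<close>

definition avg :: "(nat \<Rightarrow> nat \<Rightarrow> 'v::real_vector) \<Rightarrow> 'v" where
  "avg X = mean n (\<lambda>i. mean (nY i) (X i))"

definition Fbar :: "nat \<Rightarrow> 'a \<Rightarrow> 'b" where
  "Fbar i \<theta> = mean (nY i) (\<lambda>j. F i j \<theta>)"

definition Lgrad :: "'a \<Rightarrow> (nat \<Rightarrow> 'b) \<Rightarrow> 'a" where
  "Lgrad \<theta> w = avg (\<lambda>i j. J i j \<theta> (w i))"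

lemma avg_mono:
  fixes X Y :: "nat \<Rightarrow> nat \<Rightarrow> real"
  shows "(\<And>i j. i < n \<Longrightarrow> j < nY i \<Longrightarrow> X i j \<le> Y i j) \<Longrightarrow> avg X \<le> avg Y"
  unfolding avg_def by (intro mean_mono)

lemma avg_nonneg: "(\<And>i j. X i j \<ge> 0) \<Longrightarrow> 0 \<le> avg X" for X :: "nat \<Rightarrow> nat \<Rightarrow> real"
  unfolding avg_def mean_def by (simp add: sum_nonneg)

lemma avg_cong: "(\<And>i j. i < n \<Longrightarrow> j < nY i \<Longrightarrow> X i j = Y i j) \<Longrightarrow> avg X = avg Y"
  unfolding avg_def by (intro mean_cong)

lemma avg_row: "avg (\<lambda>i j. X i) = mean n X"
  unfolding avg_def by (intro mean_cong mean_const nY)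

lemma avg_const: "avg (\<lambda>i j. c) = c"
  using n by (simp add: avg_row mean_const)

lemma avg_add: "avg (\<lambda>i j. X i j + Y i j) = avg X + avg Y"
  unfolding avg_def by (simp add: mean_add)

lemma avg_diff: "avg (\<lambda>i j. X i j - Y i j) = avg X - avg Y"
  unfolding avg_def by (simp add: mean_diff)

lemma avg_mult_left: "avg (\<lambda>i j. c * X i j) = c * avg X" for c :: real
  unfolding avg_def by (simp add: mean_mult_left)

lemma avg_inner_right: "avg (\<lambda>i j. c \<bullet> X i j) = c \<bullet> avg X"
  unfolding avg_def by (simp add: mean_inner_right)

lemma avg_norm_center_sq_le:
  fixes X :: "nat \<Rightarrow> nat \<Rightarrow> 'v::real_inner"
  shows
  "avg (\<lambda>i j. (norm (X i j - avg X + c))\<^sup>2) \<le> avg (\<lambda>i j. (norm (X i j))\<^sup>2) + (norm c)\<^sup>2"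
proof -
  have "avg (\<lambda>i j. (norm (X i j + b))\<^sup>2) = avg (\<lambda>i j. (norm (X i j))\<^sup>2) + 2 * (avg X \<bullet> b) + (norm b)\<^sup>2" for b
  proof -
    have "avg (\<lambda>i j. (norm (X i j + b))\<^sup>2)
        = mean n (\<lambda>i. mean (nY i) (\<lambda>j. (norm (X i j))\<^sup>2) + 2 * (mean (nY i) (X i) \<bullet> b) + (norm b)\<^sup>2)"
      unfolding avg_def by (intro mean_cong mean_norm_add_sq nY)
    then show ?thesis
      using n by (simp add: avg_def mean_add mean_mult_left mean_inner_left mean_const)
  qed
  from this[of "c - avg X"] show ?thesis
    using norm_center_sq_le[of "avg X" c] by (simp add: algebra_simps)
qed

lemma norm_avg_sq_le:
  fixes X :: "nat \<Rightarrow> nat \<Rightarrow> 'v::real_inner"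
  shows "(norm (avg X))\<^sup>2 \<le> avg (\<lambda>i j. (norm (X i j))\<^sup>2)"
proof -
  have "avg (\<lambda>i j. 0) \<le> avg (\<lambda>i j. (norm (X i j - avg X))\<^sup>2)" by (rule avg_mono) simp
  moreover have "avg (\<lambda>i j. (norm (X i j - avg X))\<^sup>2)
      = avg (\<lambda>i j. (norm (X i j))\<^sup>2 + ((norm (avg X))\<^sup>2 - 2 * (avg X \<bullet> X i j)))"
    by (simp add: power2_norm_eq_inner algebra_simps inner_commute)
  ultimately show ?thesis
    by (simp add: avg_add avg_diff avg_const avg_mult_left avg_inner_right power2_norm_eq_inner)
qed

end

text \<open>The two proximal maps are opaque here: apart from \<open>prox_conj_dom\<close> they are
  known only through their proximal inequalities at the saddle point. \<open>dom i\<close> stands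
  for the domain of the conjugate.\<close>

locale primal_dual_step = composition_data n nY F J
  for n nY and F :: "nat \<Rightarrow> nat \<Rightarrow> 'a::real_inner \<Rightarrow> 'b::real_inner" and J +
  fixes dom :: "nat \<Rightarrow> 'b set" and \<theta>s :: 'a and ws :: "nat \<Rightarrow> 'b"
    and \<mu> \<gamma> Bw B\<theta> Bf \<alpha>\<theta> \<alpha>w :: real
    and prox_g :: "'a \<Rightarrow> 'a \<Rightarrow> 'a" and prox_conj :: "nat \<Rightarrow> 'b \<Rightarrow> 'b \<Rightarrow> 'b"
  assumes pos: "\<mu> > 0" "\<gamma> > 0" "Bw > 0" "B\<theta> > 0" "Bf > 0" "\<alpha>\<theta> > 0" "\<alpha>w > 0"
    and J_diff: "\<And>i j \<theta> v w. J i j \<theta> (v - w) = J i j \<theta> v - J i j \<theta> w"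
    and J_lip: "\<And>i j \<theta> \<theta>' w. i < n \<Longrightarrow> j < nY i \<Longrightarrow> norm (J i j \<theta> w - J i j \<theta>' w) \<le> B\<theta> * norm (\<theta> - \<theta>') * norm w"
    and J_bound: "\<And>i j \<theta> w. i < n \<Longrightarrow> j < nY i \<Longrightarrow> norm (J i j \<theta> w) \<le> Bf * norm w"
    and F_lip: "\<And>i j \<theta> \<theta>'. i < n \<Longrightarrow> j < nY i \<Longrightarrow> norm (F i j \<theta> - F i j \<theta>') \<le> Bf * norm (\<theta> - \<theta>')"
    and dom_bound: "\<And>i w. i < n \<Longrightarrow> w \<in> dom i \<Longrightarrow> norm w \<le> Bw"
    and ws_dom: "\<And>i. i < n \<Longrightarrow> ws i \<in> dom i"
    and L_convex: "\<And>\<theta> \<theta>' v. (\<And>i. i < n \<Longrightarrow> v i \<in> dom i) \<Longrightarrow>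
        (\<theta> - \<theta>') \<bullet> Lgrad \<theta>' v \<le> mean n (\<lambda>i. (Fbar i \<theta> - Fbar i \<theta>') \<bullet> v i)"
    and prox_conj_dom: "\<And>i \<delta> w. i < n \<Longrightarrow> prox_conj i \<delta> w \<in> dom i"
    and prox_conj: "\<And>i \<delta> w. i < n \<Longrightarrow>
        (1 / (2 * \<alpha>w)) * ((norm (prox_conj i \<delta> w - ws i))\<^sup>2 + (norm (prox_conj i \<delta> w - w))\<^sup>2
            - (norm (w - ws i))\<^sup>2) + \<gamma> * (norm (prox_conj i \<delta> w - ws i))\<^sup>2
          \<le> (prox_conj i \<delta> w - ws i) \<bullet> (\<delta> - Fbar i \<theta>s)"
    and prox_g:
        "\<And>d \<theta>. (1 / (2 * \<alpha>\<theta>)) * ((norm (prox_g d \<theta> - \<theta>s))\<^sup>2 + (norm (prox_g d \<theta> - \<theta>))\<^sup>2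
            - (norm (\<theta> - \<theta>s))\<^sup>2) + \<mu> * (norm (prox_g d \<theta> - \<theta>s))\<^sup>2
          \<le> (\<theta>s - prox_g d \<theta>) \<bullet> (d - Lgrad \<theta>s ws)"
begin

definition dist_sq :: "(nat \<Rightarrow> 'b) \<Rightarrow> real" where
  "dist_sq w = (\<Sum>i<n. (norm (w i - ws i))\<^sup>2)"

text \<open>
  Coordinates outside the domain of the conjugate can only come from the initial point.
\<close>

definition outside_sq :: "(nat \<Rightarrow> 'b) \<Rightarrow> real" where
  "outside_sq w = (\<Sum>i<n. if w i \<in> dom i then 0 else (norm (w i - ws i))\<^sup>2)"

definition coupling :: "'a \<Rightarrow> (nat \<Rightarrow> 'b) \<Rightarrow> real" where
  "coupling \<theta> w = mean n (\<lambda>i. (Fbar i \<theta> - Fbar i \<theta>s) \<bullet> (w i - ws i))"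

definition dual_step :: "'a \<Rightarrow> 'a \<Rightarrow> (nat \<Rightarrow> 'b) \<Rightarrow> nat \<Rightarrow> nat \<Rightarrow> nat \<Rightarrow> 'b" where
  "dual_step \<theta>t \<theta> w i j = w(i := prox_conj i (F i j \<theta> - F i j \<theta>t + Fbar i \<theta>t) (w i))"

definition primal_step :: "'a \<Rightarrow> 'a \<Rightarrow> (nat \<Rightarrow> 'b) \<Rightarrow> nat \<Rightarrow> nat \<Rightarrow> 'a" where
  "primal_step \<theta>t \<theta> w i j = prox_g (J i j \<theta> (w i) - J i j \<theta>t (w i) + Lgrad \<theta>t w) \<theta>"

section \<open>Noise, drift and progress bounds for the two steps\<close>

lemma Fbar_lip:
  assumes "i < n" shows "norm (Fbar i \<theta> - Fbar i \<theta>') \<le> Bf * norm (\<theta> - \<theta>')"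
proof -
  have "norm (Fbar i \<theta> - Fbar i \<theta>') = norm (\<Sum>j<nY i. F i j \<theta> - F i j \<theta>') / real (nY i)"
    unfolding Fbar_def mean_def by (simp add: sum_subtractf scaleR_diff_right[symmetric])
  also have "\<dots> \<le> (\<Sum>j<nY i. Bf * norm (\<theta> - \<theta>')) / real (nY i)"
    by (intro divide_right_mono sum_norm_le F_lip assms) auto
  finally show ?thesis using nY[OF assms] by simp
qed

text \<open>In the domain, the Lipschitz bound in \<theta> together with \<open>Bw\<close> makes the
  noise small near the reference point. Outside, \<open>w i\<close> is split into
  \<open>ws i\<close>, treated the same way, and a rest controlled by \<open>Bf\<close> alone; the 8
  is 2 times the square of \<open>2 * Bf * norm ?v\<close> stripped of its variables.\<close>

lemma primal_noise:
  assumes "i < n" "j < nY i"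
  shows "(norm (J i j \<theta> (w i) - J i j \<theta>t (w i)))\<^sup>2
    \<le> 2 * (B\<theta> * Bw * norm (\<theta> - \<theta>t))\<^sup>2 + 8 * Bf\<^sup>2 * (if w i \<in> dom i then 0 else (norm (w i - ws i))\<^sup>2)"
proof -
  have dm: "(norm (J i j \<theta> v - J i j \<theta>t v))\<^sup>2 \<le> (B\<theta> * Bw * norm (\<theta> - \<theta>t))\<^sup>2" if "v \<in> dom i" for v
  proof (rule power_mono)
    have "norm (J i j \<theta> v - J i j \<theta>t v) \<le> B\<theta> * norm (\<theta> - \<theta>t) * norm v" by (rule J_lip[OF assms])
    also have "\<dots> \<le> B\<theta> * norm (\<theta> - \<theta>t) * Bw"
      using dom_bound[OF assms(1) that] pos by (intro mult_left_mono) auto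
    finally show "norm (J i j \<theta> v - J i j \<theta>t v) \<le> B\<theta> * Bw * norm (\<theta> - \<theta>t)" by (simp add: mult_ac)
  qed simp
  show ?thesis
  proof (cases "w i \<in> dom i")
    case True
    then show ?thesis
      using dm[OF True] zero_le_power2[of "B\<theta> * Bw * norm (\<theta> - \<theta>t)"] by (auto intro: order_trans)
  next
    case False
    let ?v = "w i - ws i"
    have eq: "J i j \<theta> (w i) - J i j \<theta>t (w i)
        = (J i j \<theta> (ws i) - J i j \<theta>t (ws i)) + (J i j \<theta> ?v - J i j \<theta>t ?v)"
      by (simp add: J_diff)
    have "norm (J i j \<theta> ?v - J i j \<theta>t ?v) \<le> norm (J i j \<theta> ?v) + norm (J i j \<theta>t ?v)"
      by (rule norm_triangle_ineq4)
    also have "\<dots> \<le> 2 * Bf * norm ?v"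
      using J_bound[OF assms, of \<theta> ?v] J_bound[OF assms, of \<theta>t ?v] by simp
    finally have "(norm (J i j \<theta> ?v - J i j \<theta>t ?v))\<^sup>2 \<le> (2 * Bf * norm ?v)\<^sup>2"
      by (rule power_mono) simp
    then show ?thesis
      using False dm[OF ws_dom[OF assms(1)]]
        norm_add_sq_le[of "J i j \<theta> (ws i) - J i j \<theta>t (ws i)" "J i j \<theta> ?v - J i j \<theta>t ?v"]
      unfolding eq by (simp add: power_mult_distrib)
  qed
qed

text \<open>The difference is split at \<open>J i j \<theta> (ws i)\<close>: the change of the dual
  vector costs \<open>Bf\<close>, and the change of \<theta> costs \<open>B\<theta> * Bw\<close>
  because \<open>ws i\<close> lies in the domain.\<close>

lemma primal_drift:
  "(norm (Lgrad \<theta> w - Lgrad \<theta>s ws))\<^sup>2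
    \<le> 2 * Bf\<^sup>2 * dist_sq w / real n + 2 * (B\<theta> * Bw * norm (\<theta> - \<theta>s))\<^sup>2"
proof -
  have "(norm (Lgrad \<theta> w - Lgrad \<theta>s ws))\<^sup>2 \<le> avg (\<lambda>i j. (norm (J i j \<theta> (w i) - J i j \<theta>s (ws i)))\<^sup>2)"
    unfolding Lgrad_def avg_diff[symmetric] by (rule norm_avg_sq_le)
  also have "\<dots> \<le> avg (\<lambda>i j. 2 * Bf\<^sup>2 * (norm (w i - ws i))\<^sup>2 + 2 * (B\<theta> * Bw * norm (\<theta> - \<theta>s))\<^sup>2)"
  proof (rule avg_mono)
    fix i j assume ij: "i < n" "j < nY i"
    have eq: "J i j \<theta> (w i) - J i j \<theta>s (ws i) = J i j \<theta> (w i - ws i) + (J i j \<theta> (ws i) - J i j \<theta>s (ws i))"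
      by (simp add: J_diff)
    have "(norm (J i j \<theta> (w i - ws i)))\<^sup>2 \<le> (Bf * norm (w i - ws i))\<^sup>2"
      using J_bound[OF ij] by (rule power_mono) simp
    moreover have "norm (J i j \<theta> (ws i) - J i j \<theta>s (ws i)) \<le> B\<theta> * Bw * norm (\<theta> - \<theta>s)"
    proof -
      have "norm (J i j \<theta> (ws i) - J i j \<theta>s (ws i)) \<le> B\<theta> * norm (\<theta> - \<theta>s) * norm (ws i)" by (rule J_lip[OF ij])
      also have "\<dots> \<le> B\<theta> * norm (\<theta> - \<theta>s) * Bw"
        using dom_bound[OF ij(1) ws_dom[OF ij(1)]] pos by (intro mult_left_mono) auto
      finally show ?thesis by (simp add: mult_ac)
    qed
    then have "(norm (J i j \<theta> (ws i) - J i j \<theta>s (ws i)))\<^sup>2 \<le> (B\<theta> * Bw * norm (\<theta> - \<theta>s))\<^sup>2"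
      by (rule power_mono) simp
    ultimately show "(norm (J i j \<theta> (w i) - J i j \<theta>s (ws i)))\<^sup>2
        \<le> 2 * Bf\<^sup>2 * (norm (w i - ws i))\<^sup>2 + 2 * (B\<theta> * Bw * norm (\<theta> - \<theta>s))\<^sup>2"
      using norm_add_sq_le[of "J i j \<theta> (w i - ws i)" "J i j \<theta> (ws i) - J i j \<theta>s (ws i)"]
      unfolding eq by (simp add: power_mult_distrib)
  qed
  also have "\<dots> = 2 * Bf\<^sup>2 * dist_sq w / real n + 2 * (B\<theta> * Bw * norm (\<theta> - \<theta>s))\<^sup>2"
    unfolding avg_add avg_const avg_mult_left avg_row by (simp add: mean_def dist_sq_def)
  finally show ?thesis .
qed

text \<open>
  Convexity of the Lagrangian is applied to \<open>w\<close> with its coordinates outside the domain replaced by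
  those of \<open>ws\<close>.
\<close>

lemma primal_coupling:
  "(\<theta>s - \<theta>) \<bullet> (Lgrad \<theta> w - Lgrad \<theta>s ws)
    \<le> - coupling \<theta> w + \<mu> / 8 * (norm (\<theta> - \<theta>s))\<^sup>2 + 8 * Bf\<^sup>2 / \<mu> * outside_sq w / real n"
proof -
  define v where "v i = (if w i \<in> dom i then w i else ws i)" for i
  have v: "v i \<in> dom i" if "i < n" for i using ws_dom that by (simp add: v_def)
  \<comment> \<open>Convexity is used in both directions, from \<theta> to \<open>\<theta>s\<close>
    at \<open>v\<close> and back at \<open>ws\<close>. The sum of the two is minus the coupling, up
    to the error of replacing \<open>w\<close> by \<open>v\<close>.\<close>
  have 1: "(\<theta>s - \<theta>) \<bullet> Lgrad \<theta> v \<le> mean n (\<lambda>i. (Fbar i \<theta>s - Fbar i \<theta>) \<bullet> v i)"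
    using v by (rule L_convex)
  have 2: "(\<theta> - \<theta>s) \<bullet> Lgrad \<theta>s ws \<le> mean n (\<lambda>i. (Fbar i \<theta> - Fbar i \<theta>s) \<bullet> ws i)"
    using ws_dom by (rule L_convex)
  have 3: "(\<theta>s - \<theta>) \<bullet> (Lgrad \<theta> w - Lgrad \<theta> v) + mean n (\<lambda>i. (Fbar i \<theta> - Fbar i \<theta>s) \<bullet> (w i - v i))
      \<le> \<mu> / 8 * (norm (\<theta> - \<theta>s))\<^sup>2 + 8 * Bf\<^sup>2 / \<mu> * outside_sq w / real n"
  proof -
    have "(\<theta>s - \<theta>) \<bullet> (Lgrad \<theta> w - Lgrad \<theta> v) + mean n (\<lambda>i. (Fbar i \<theta> - Fbar i \<theta>s) \<bullet> (w i - v i))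
        = avg (\<lambda>i j. (\<theta>s - \<theta>) \<bullet> J i j \<theta> (w i - v i) + (Fbar i \<theta> - Fbar i \<theta>s) \<bullet> (w i - v i))"
      unfolding Lgrad_def avg_add avg_row avg_inner_right J_diff avg_diff ..
    also have "\<dots> \<le> avg (\<lambda>i j. \<mu> / 8 * (norm (\<theta> - \<theta>s))\<^sup>2
        + 8 * Bf\<^sup>2 / \<mu> * (if w i \<in> dom i then 0 else (norm (w i - ws i))\<^sup>2))"
    proof (rule avg_mono)
      fix i j assume ij: "i < n" "j < nY i"
      define e where "e = norm (w i - v i)"
      have "(\<theta>s - \<theta>) \<bullet> J i j \<theta> (w i - v i) \<le> norm (\<theta>s - \<theta>) * norm (J i j \<theta> (w i - v i))"
        by (rule norm_cauchy_schwarz)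
      also have "\<dots> \<le> norm (\<theta> - \<theta>s) * (Bf * e)"
        unfolding norm_minus_commute[of \<theta>s] e_def by (intro mult_left_mono J_bound ij) simp
      finally have a: "(\<theta>s - \<theta>) \<bullet> J i j \<theta> (w i - v i) \<le> norm (\<theta> - \<theta>s) * (Bf * e)" .
      have "(Fbar i \<theta> - Fbar i \<theta>s) \<bullet> (w i - v i) \<le> norm (Fbar i \<theta> - Fbar i \<theta>s) * e"
        unfolding e_def by (rule norm_cauchy_schwarz)
      also have "\<dots> \<le> (Bf * norm (\<theta> - \<theta>s)) * e"
        unfolding e_def by (intro mult_right_mono Fbar_lip ij) simp
      finally have b: "(Fbar i \<theta> - Fbar i \<theta>s) \<bullet> (w i - v i) \<le> (Bf * norm (\<theta> - \<theta>s)) * e" .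
      \<comment> \<open>The bounds \<open>a\<close> and \<open>b\<close> are the same product, hence
        the factor 2. The weight \<open>4 / \<mu>\<close> leaves \<open>\<mu> / 8\<close> on the
        primal distance, which \<open>rate_primal\<close> can afford.\<close>
      have "norm (\<theta> - \<theta>s) \<bullet> (2 * Bf * e)
          \<le> 1 / (2 * (4 / \<mu>)) * (norm (norm (\<theta> - \<theta>s)))\<^sup>2 + (4 / \<mu>) / 2 * (norm (2 * Bf * e))\<^sup>2"
        using pos by (intro inner_le_weighted_sq) simp
      also have "\<dots> = \<mu> / 8 * (norm (\<theta> - \<theta>s))\<^sup>2 + 8 * Bf\<^sup>2 / \<mu> * e\<^sup>2"
        by (simp add: power_mult_distrib)
      also have "e\<^sup>2 = (if w i \<in> dom i then 0 else (norm (w i - ws i))\<^sup>2)"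
        by (simp add: e_def v_def)
      finally show "(\<theta>s - \<theta>) \<bullet> J i j \<theta> (w i - v i) + (Fbar i \<theta> - Fbar i \<theta>s) \<bullet> (w i - v i)
        \<le> \<mu> / 8 * (norm (\<theta> - \<theta>s))\<^sup>2 + 8 * Bf\<^sup>2 / \<mu> * (if w i \<in> dom i then 0 else (norm (w i - ws i))\<^sup>2)"
        using a b by (simp add: mult_ac)
    qed
    also have "\<dots> = \<mu> / 8 * (norm (\<theta> - \<theta>s))\<^sup>2 + 8 * Bf\<^sup>2 / \<mu> * outside_sq w / real n"
      unfolding avg_add avg_const avg_mult_left avg_row by (simp add: mean_def outside_sq_def)
    finally show ?thesis .
  qed
  have "coupling \<theta> w = mean n (\<lambda>i. (Fbar i \<theta> - Fbar i \<theta>s) \<bullet> (w i - v i))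
      - mean n (\<lambda>i. (Fbar i \<theta>s - Fbar i \<theta>) \<bullet> v i) - mean n (\<lambda>i. (Fbar i \<theta> - Fbar i \<theta>s) \<bullet> ws i)"
    unfolding coupling_def mean_diff[symmetric] by (simp add: algebra_simps)
  with 1 2 3 show ?thesis by (simp add: inner_diff_left inner_diff_right)
qed

text \<open>The sampled direction is unbiased, so its product with
  \<open>\<theta>s - \<theta>\<close>, which does not depend on the sample, averages to the full
  gradient. The product with \<open>\<theta> - z\<close> does depend on it; Young's inequality
  splits it into the squared move, which the proximal inequality cancels, and the noise.\<close>

lemma primal_progress:
  "(1 / (2 * \<alpha>\<theta>) + \<mu>) * avg (\<lambda>i j. (norm (primal_step \<theta>t \<theta> w i j - \<theta>s))\<^sup>2)
    \<le> (1 / (2 * \<alpha>\<theta>) + \<mu> / 8) * (norm (\<theta> - \<theta>s))\<^sup>2 - coupling \<theta> w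
      + \<alpha>\<theta> * (B\<theta> * Bw)\<^sup>2 * ((norm (\<theta> - \<theta>t))\<^sup>2 + (norm (\<theta> - \<theta>s))\<^sup>2)
      + \<alpha>\<theta> * Bf\<^sup>2 * (4 * outside_sq w + dist_sq w) / real n
      + 8 * Bf\<^sup>2 / \<mu> * outside_sq w / real n"
proof -
  let ?Ls = "Lgrad \<theta>s ws"
  let ?X = "\<lambda>i j. J i j \<theta> (w i) - J i j \<theta>t (w i)"
  have avgX: "avg ?X = Lgrad \<theta> w - Lgrad \<theta>t w" by (simp add: avg_diff Lgrad_def)
  let ?d = "\<lambda>i j. ?X i j + Lgrad \<theta>t w"
  have one: "(1 / (2 * \<alpha>\<theta>) + \<mu>) * (norm (primal_step \<theta>t \<theta> w i j - \<theta>s))\<^sup>2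
      \<le> 1 / (2 * \<alpha>\<theta>) * (norm (\<theta> - \<theta>s))\<^sup>2 + (\<theta>s - \<theta>) \<bullet> (?d i j - ?Ls)
        + \<alpha>\<theta> / 2 * (norm (?X i j - avg ?X + (Lgrad \<theta> w - ?Ls)))\<^sup>2" for i j
  proof -
    define z where "z = primal_step \<theta>t \<theta> w i j"
    have eq: "?X i j - avg ?X + (Lgrad \<theta> w - ?Ls) = ?d i j - ?Ls" by (simp add: avgX)
    have "(1 / (2 * \<alpha>\<theta>)) * ((norm (z - \<theta>s))\<^sup>2 + (norm (z - \<theta>))\<^sup>2 - (norm (\<theta> - \<theta>s))\<^sup>2)
        + \<mu> * (norm (z - \<theta>s))\<^sup>2 \<le> (\<theta>s - z) \<bullet> (?d i j - ?Ls)"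
      unfolding z_def primal_step_def by (rule prox_g)
    moreover have "(\<theta>s - z) \<bullet> (?d i j - ?Ls) = (\<theta>s - \<theta>) \<bullet> (?d i j - ?Ls) + (\<theta> - z) \<bullet> (?d i j - ?Ls)"
      by (simp add: inner_diff_left)
    moreover have "(\<theta> - z) \<bullet> (?d i j - ?Ls)
        \<le> 1 / (2 * \<alpha>\<theta>) * (norm (\<theta> - z))\<^sup>2 + \<alpha>\<theta> / 2 * (norm (?d i j - ?Ls))\<^sup>2"
      using pos by (intro inner_le_weighted_sq)
    ultimately show ?thesis unfolding eq z_def[symmetric]
      by (simp add: norm_minus_commute[of \<theta> z] ring_distribs)
  qed
  have "avg (\<lambda>i j. (\<theta>s - \<theta>) \<bullet> (?d i j - ?Ls)) = (\<theta>s - \<theta>) \<bullet> (Lgrad \<theta> w - ?Ls)"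
    unfolding avg_inner_right avg_diff avg_add avg_const by (simp add: Lgrad_def)
  moreover have "avg (\<lambda>i j. (norm (?X i j - avg ?X + (Lgrad \<theta> w - ?Ls)))\<^sup>2)
      \<le> avg (\<lambda>i j. (norm (?X i j))\<^sup>2) + (norm (Lgrad \<theta> w - ?Ls))\<^sup>2"
    by (rule avg_norm_center_sq_le)
  moreover have "avg (\<lambda>i j. (norm (?X i j))\<^sup>2)
      \<le> 2 * (B\<theta> * Bw * norm (\<theta> - \<theta>t))\<^sup>2 + 8 * Bf\<^sup>2 * outside_sq w / real n"
  proof -
    have "avg (\<lambda>i j. (norm (?X i j))\<^sup>2) \<le> avg (\<lambda>i j. 2 * (B\<theta> * Bw * norm (\<theta> - \<theta>t))\<^sup>2
        + 8 * Bf\<^sup>2 * (if w i \<in> dom i then 0 else (norm (w i - ws i))\<^sup>2))"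
      by (intro avg_mono primal_noise)
    also have "\<dots> = 2 * (B\<theta> * Bw * norm (\<theta> - \<theta>t))\<^sup>2 + 8 * Bf\<^sup>2 * outside_sq w / real n"
      unfolding avg_add avg_const avg_mult_left avg_row by (simp add: mean_def outside_sq_def)
    finally show ?thesis .
  qed
  moreover have "(1 / (2 * \<alpha>\<theta>) + \<mu>) * avg (\<lambda>i j. (norm (primal_step \<theta>t \<theta> w i j - \<theta>s))\<^sup>2)
      \<le> 1 / (2 * \<alpha>\<theta>) * (norm (\<theta> - \<theta>s))\<^sup>2 + avg (\<lambda>i j. (\<theta>s - \<theta>) \<bullet> (?d i j - ?Ls))
        + \<alpha>\<theta> / 2 * avg (\<lambda>i j. (norm (?X i j - avg ?X + (Lgrad \<theta> w - ?Ls)))\<^sup>2)"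
    using avg_mono[OF one] by (simp only: avg_mult_left avg_add avg_const)
  ultimately have "(1 / (2 * \<alpha>\<theta>) + \<mu>) * avg (\<lambda>i j. (norm (primal_step \<theta>t \<theta> w i j - \<theta>s))\<^sup>2)
      \<le> 1 / (2 * \<alpha>\<theta>) * (norm (\<theta> - \<theta>s))\<^sup>2
        + (- coupling \<theta> w + \<mu> / 8 * (norm (\<theta> - \<theta>s))\<^sup>2 + 8 * Bf\<^sup>2 / \<mu> * outside_sq w / real n)
        + \<alpha>\<theta> / 2 * (2 * (B\<theta> * Bw * norm (\<theta> - \<theta>t))\<^sup>2 + 8 * Bf\<^sup>2 * outside_sq w / real n
          + (2 * Bf\<^sup>2 * dist_sq w / real n + 2 * (B\<theta> * Bw * norm (\<theta> - \<theta>s))\<^sup>2))"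
    using primal_coupling[of \<theta> w] primal_drift[of \<theta> w] pos
    by (smt (verit) mult_left_mono half_gt_zero)
  also have "\<dots> = (1 / (2 * \<alpha>\<theta>) + \<mu> / 8) * (norm (\<theta> - \<theta>s))\<^sup>2 - coupling \<theta> w
      + \<alpha>\<theta> * (B\<theta> * Bw)\<^sup>2 * ((norm (\<theta> - \<theta>t))\<^sup>2 + (norm (\<theta> - \<theta>s))\<^sup>2)
      + \<alpha>\<theta> * Bf\<^sup>2 * (4 * outside_sq w + dist_sq w) / real n
      + 8 * Bf\<^sup>2 / \<mu> * outside_sq w / real n"
    by (simp add: power_mult_distrib algebra_simps add_divide_distrib)
  finally show ?thesis .
qed

text \<open>Only coordinate \<open>i\<close> moves, so the coupling gains just \<open>1 / n\<close>
  of \<open>?G i \<bullet> (z - w i)\<close>, whereas the proximal inequality contains this product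
  with weight one. The excess, with factor \<open>1 - 1 / real n\<close>, joins the sampling noise
  in \<open>?r\<close> and is absorbed by the squared move.\<close>

lemma dual_progress:
  "(1 / (2 * \<alpha>w) + \<gamma>) * avg (\<lambda>i j. dist_sq (dual_step \<theta>t \<theta> w i j))
    \<le> (1 / (2 * \<alpha>w) + \<gamma> - \<gamma> / real n) * dist_sq w + avg (\<lambda>i j. coupling \<theta> (dual_step \<theta>t \<theta> w i j))
      + \<alpha>w / 2 * Bf\<^sup>2 * ((norm (\<theta> - \<theta>t))\<^sup>2 + (norm (\<theta> - \<theta>s))\<^sup>2)"
proof -
  let ?G = "\<lambda>i. Fbar i \<theta> - Fbar i \<theta>s"
  let ?X = "\<lambda>i j. F i j \<theta> - F i j \<theta>t"
  have meanX: "mean (nY i) (?X i) = Fbar i \<theta> - Fbar i \<theta>t" for i by (simp add: mean_diff Fbar_def)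
  let ?d = "\<lambda>i j. ?X i j + Fbar i \<theta>t"
  let ?r = "\<lambda>i j. ?X i j - mean (nY i) (?X i) + (1 - 1 / real n) *\<^sub>R ?G i"
  have one: "(1 / (2 * \<alpha>w) + \<gamma>) * (dist_sq (dual_step \<theta>t \<theta> w i j) - dist_sq w) + \<gamma> * (norm (w i - ws i))\<^sup>2
      \<le> (w i - ws i) \<bullet> (?d i j - Fbar i \<theta>s) + coupling \<theta> (dual_step \<theta>t \<theta> w i j) - coupling \<theta> w
        + \<alpha>w / 2 * (norm (?r i j))\<^sup>2" if i: "i < n" for i j
  proof -
    define z where "z = prox_conj i (?d i j) (w i)"
    have w': "dual_step \<theta>t \<theta> w i j = w(i := z)" by (simp add: dual_step_def z_def)
    have 1: "dist_sq (dual_step \<theta>t \<theta> w i j) = dist_sq w - (norm (w i - ws i))\<^sup>2 + (norm (z - ws i))\<^sup>2"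
      unfolding w' dist_sq_def using sum_fun_upd[OF i, of "\<lambda>l v. (norm (v - ws l))\<^sup>2"] .
    have "real n * coupling \<theta> (dual_step \<theta>t \<theta> w i j) = real n * coupling \<theta> w + ?G i \<bullet> (z - w i)"
      unfolding w' coupling_def mean_def using n sum_fun_upd[OF i, of "\<lambda>l v. ?G l \<bullet> (v - ws l)" w z]
      by (simp add: inner_diff_right)
    then have 2: "coupling \<theta> (dual_step \<theta>t \<theta> w i j) = coupling \<theta> w + (1 / real n) * (?G i \<bullet> (z - w i))"
      using n by (simp add: field_simps)
    have 3: "(1 / (2 * \<alpha>w)) * ((norm (z - ws i))\<^sup>2 + (norm (z - w i))\<^sup>2 - (norm (w i - ws i))\<^sup>2)
        + \<gamma> * (norm (z - ws i))\<^sup>2 \<le> (z - ws i) \<bullet> (?d i j - Fbar i \<theta>s)"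
      unfolding z_def by (rule prox_conj[OF i])
    define r where "r = ?r i j"
    have d: "?d i j - Fbar i \<theta>s = (1 / real n) *\<^sub>R ?G i + r"
      unfolding r_def by (simp add: meanX scaleR_diff_left)
    have 4: "(z - ws i) \<bullet> (?d i j - Fbar i \<theta>s)
        = (w i - ws i) \<bullet> (?d i j - Fbar i \<theta>s) + (1 / real n) * (?G i \<bullet> (z - w i)) + (z - w i) \<bullet> r"
      unfolding d inner_add_right inner_scaleR_right inner_commute[of _ "?G i"]
      by (simp add: inner_diff_left inner_diff_right algebra_simps)
    have "(z - w i) \<bullet> r \<le> 1 / (2 * \<alpha>w) * (norm (z - w i))\<^sup>2 + \<alpha>w / 2 * (norm r)\<^sup>2"
      using pos by (intro inner_le_weighted_sq)
    with 3 show ?thesis unfolding 1 2 4 r_def[symmetric] by (simp only: ring_distribs)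
  qed
  \<comment> \<open>This average cancels the old coupling subtracted in \<open>one\<close>.\<close>
  have "avg (\<lambda>i j. (w i - ws i) \<bullet> (?d i j - Fbar i \<theta>s)) = coupling \<theta> w"
  proof -
    have "mean (nY i) (\<lambda>j. (w i - ws i) \<bullet> (?d i j - Fbar i \<theta>s)) = ?G i \<bullet> (w i - ws i)" if "i < n" for i
      using nY[OF that] unfolding mean_inner_right mean_diff mean_add
      by (simp add: mean_const Fbar_def[symmetric] inner_commute)
    then show ?thesis unfolding avg_def coupling_def by (rule mean_cong)
  qed
  moreover have "avg (\<lambda>i j. (norm (?r i j))\<^sup>2) \<le> Bf\<^sup>2 * ((norm (\<theta> - \<theta>t))\<^sup>2 + (norm (\<theta> - \<theta>s))\<^sup>2)"
    unfolding avg_def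
  proof (rule mean_le[OF n])
    fix i assume i: "i < n"
    have "mean (nY i) (\<lambda>j. (norm (?r i j))\<^sup>2)
        \<le> mean (nY i) (\<lambda>j. (norm (?X i j))\<^sup>2) + (norm ((1 - 1 / real n) *\<^sub>R ?G i))\<^sup>2"
      by (rule mean_norm_center_sq_le[OF nY[OF i]])
    also have "mean (nY i) (\<lambda>j. (norm (?X i j))\<^sup>2) \<le> (Bf * norm (\<theta> - \<theta>t))\<^sup>2"
      by (intro mean_le nY i power_mono F_lip) auto
    also have "(norm ((1 - 1 / real n) *\<^sub>R ?G i))\<^sup>2 \<le> (Bf * norm (\<theta> - \<theta>s))\<^sup>2"
    proof (rule power_mono)
      have "\<bar>1 - 1 / real n\<bar> \<le> 1" using n by simp
      then have "norm ((1 - 1 / real n) *\<^sub>R ?G i) \<le> norm (?G i)"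
        by (simp add: mult_left_le_one_le)
      also have "\<dots> \<le> Bf * norm (\<theta> - \<theta>s)" by (rule Fbar_lip[OF i])
      finally show "norm ((1 - 1 / real n) *\<^sub>R ?G i) \<le> Bf * norm (\<theta> - \<theta>s)" .
    qed simp
    finally show "mean (nY i) (\<lambda>j. (norm (?r i j))\<^sup>2) \<le> Bf\<^sup>2 * ((norm (\<theta> - \<theta>t))\<^sup>2 + (norm (\<theta> - \<theta>s))\<^sup>2)"
      by (simp add: power_mult_distrib ring_distribs)
  qed
  moreover have "avg (\<lambda>i j. (norm (w i - ws i))\<^sup>2) = dist_sq w / real n"
    by (simp add: avg_row mean_def dist_sq_def)
  moreover have "(1 / (2 * \<alpha>w) + \<gamma>) * (avg (\<lambda>i j. dist_sq (dual_step \<theta>t \<theta> w i j)) - dist_sq w)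
      + \<gamma> * avg (\<lambda>i j. (norm (w i - ws i))\<^sup>2)
      \<le> avg (\<lambda>i j. (w i - ws i) \<bullet> (?d i j - Fbar i \<theta>s)) + avg (\<lambda>i j. coupling \<theta> (dual_step \<theta>t \<theta> w i j))
        - coupling \<theta> w + \<alpha>w / 2 * avg (\<lambda>i j. (norm (?r i j))\<^sup>2)"
    using avg_mono[OF one] by (simp only: avg_mult_left avg_add avg_diff avg_const)
  ultimately have "(1 / (2 * \<alpha>w) + \<gamma>) * (avg (\<lambda>i j. dist_sq (dual_step \<theta>t \<theta> w i j)) - dist_sq w)
      + \<gamma> * (dist_sq w / real n) \<le> avg (\<lambda>i j. coupling \<theta> (dual_step \<theta>t \<theta> w i j))
        + \<alpha>w / 2 * (Bf\<^sup>2 * ((norm (\<theta> - \<theta>t))\<^sup>2 + (norm (\<theta> - \<theta>s))\<^sup>2))"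
    using pos by (smt (verit) mult_left_mono half_gt_zero)
  then show ?thesis by (simp add: ring_distribs diff_divide_distrib)
qed

text \<open>The sampled coordinate lands in the domain and loses its whole contribution, and each
  coordinate is sampled with probability \<open>1 / n\<close>.\<close>

lemma outside_progress:
  "avg (\<lambda>i j. outside_sq (dual_step \<theta>t \<theta> w i j)) = (1 - 1 / real n) * outside_sq w"
proof -
  have "avg (\<lambda>i j. outside_sq (dual_step \<theta>t \<theta> w i j))
      = avg (\<lambda>i j. outside_sq w - (if w i \<in> dom i then 0 else (norm (w i - ws i))\<^sup>2))"
  proof (rule avg_cong)
    fix i j assume i: "i < n"
    show "outside_sq (dual_step \<theta>t \<theta> w i j)
        = outside_sq w - (if w i \<in> dom i then 0 else (norm (w i - ws i))\<^sup>2)"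
      using sum_fun_upd[OF i, of "\<lambda>l v. if v \<in> dom l then 0 else (norm (v - ws l))\<^sup>2" w
          "prox_conj i (F i j \<theta> - F i j \<theta>t + Fbar i \<theta>t) (w i)"] prox_conj_dom[OF i]
      unfolding outside_sq_def dual_step_def by simp
  qed
  also have "\<dots> = (1 - 1 / real n) * outside_sq w"
    unfolding avg_diff avg_const avg_row by (simp add: mean_def outside_sq_def left_diff_distrib)
  finally show ?thesis .
qed

end

section \<open>Step sizes, contraction rate and potential\<close>

locale svrpda_rates = primal_dual_step +
  fixes \<kappa> :: real
  assumes \<kappa>: "\<kappa> = Bf\<^sup>2 / (\<gamma> * \<mu>) + Bw\<^sup>2 * B\<theta>\<^sup>2 / \<mu>\<^sup>2"
    and \<alpha>\<theta>: "\<alpha>\<theta> = 1 / (real n * \<mu> * (64 * \<kappa> + 1))"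
    and \<alpha>w: "\<alpha>w = real n * \<mu> / \<gamma> * \<alpha>\<theta>"
begin

definition lyapunov :: "'a \<Rightarrow> (nat \<Rightarrow> 'b) \<Rightarrow> real" where
  "lyapunov \<theta> w = (norm (\<theta> - \<theta>s))\<^sup>2
     + \<gamma> / \<mu> * ((64 * \<kappa> + 3) / (64 * real n * \<kappa> + real n + 1)) * dist_sq w"

text \<open>The denominator of the dual Lyapunov weight; \<open>scale - 1\<close> is
  \<open>1 / (\<mu> * \<alpha>\<theta>)\<close>.\<close>

definition scale :: real where
  "scale = real n * (64 * \<kappa> + 1) + 1"

definition rate :: real where
  "rate = 1 - 3 / 5 / scale"

text \<open>
  The weights are those of \<open>lyapunov\<close>, multiplied by \<open>\<mu> / 2 * scale\<close>, up to the correction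
  \<open>\<gamma> / (64 n)\<close> that absorbs the stochastic noise. The last term decays by the factor \<open>1 - 1 / n\<close>,
  faster than \<open>rate\<close>, and the difference pays for the errors caused by those coordinates.
\<close>

definition potential :: "'a \<Rightarrow> (nat \<Rightarrow> 'b) \<Rightarrow> real" where
  "potential \<theta> w = \<mu> / 2 * scale * (norm (\<theta> - \<theta>s))\<^sup>2
     + (\<gamma> / 2 * (64 * \<kappa> + 3) - \<gamma> / (64 * real n)) * dist_sq w
     + \<gamma> / 8 * (64 * \<kappa> + 3) * outside_sq w"

lemma \<kappa>_nonneg: "\<kappa> \<ge> 0"
  using pos by (simp add: \<kappa>)

lemma scale_eq: "scale = 64 * (real n * \<kappa>) + real n + 1"
  by (simp add: scale_def algebra_simps)

lemma scale_gt: "scale > real n" "scale \<ge> 2"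
proof -
  have "real n * \<kappa> \<ge> 0" using \<kappa>_nonneg by simp
  then show "scale > real n" "scale \<ge> 2" using n by (simp_all add: scale_eq)
qed

lemma rate_bounds: "0 \<le> rate" "rate < 1"
  using scale_gt by (auto simp: rate_def field_simps)

lemma dist_sq_nonneg: "dist_sq w \<ge> 0"
  by (simp add: dist_sq_def sum_nonneg)

lemma outside_sq_nonneg: "outside_sq w \<ge> 0"
  by (simp add: outside_sq_def sum_nonneg)

lemma outside_sq_le: "outside_sq w \<le> dist_sq w"
  unfolding outside_sq_def dist_sq_def by (intro sum_mono) auto

text \<open>A step gains \<open>\<mu> / 2\<close>. Of this, 1/8 \<mu> pays for the coupling outside
  the domain and 3/64 \<mu> for the noise. The remaining 21/64 \<mu> covers the 3/10 \<mu> taken by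
  \<open>rate\<close>, whose constant 3/5 is a round value below 21/32.\<close>

lemma rate_primal:
  "\<mu> / 2 * (scale - 1) + (\<mu> / 8 + 3 / 64 * \<mu>) \<le> rate * (\<mu> / 2 * scale)"
proof -
  have "rate * (\<mu> / 2 * scale) = \<mu> / 2 * scale - 3 / 10 * \<mu>"
    using scale_gt by (simp add: rate_def field_simps)
  then show ?thesis using pos by (simp add: field_simps)
qed

text \<open>Since \<open>(64 * \<kappa> + 3) / scale\<close> is at most \<open>3 / real n\<close>,
  \<open>rate\<close> takes at most 9/10 of the gain \<open>\<gamma> / real n\<close>; the
  correction in the potential takes 1/64 of it.\<close>

lemma rate_dual:
  "\<gamma> / 2 * (64 * \<kappa> + 3) - \<gamma> / real n
    \<le> rate * (\<gamma> / 2 * (64 * \<kappa> + 3) - \<gamma> / (64 * real n))"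
proof -
  have n0: "real n > 0" using n by simp
  have "(64 * \<kappa> + 3) * real n \<le> 3 * scale"
    using \<kappa>_nonneg n by (simp add: scale_def algebra_simps)
  then have "(64 * \<kappa> + 3) / scale \<le> 3 / real n"
    using scale_gt n0 by (simp add: field_simps)
  then have "3 / 10 * \<gamma> * ((64 * \<kappa> + 3) / scale) \<le> 3 / 10 * \<gamma> * (3 / real n)"
    using pos by (intro mult_left_mono) auto
  moreover have "3 / 5 / scale * (\<gamma> / (64 * real n)) \<ge> 0" using pos scale_gt by simp
  moreover have "rate * (\<gamma> / 2 * (64 * \<kappa> + 3) - \<gamma> / (64 * real n))
      = (\<gamma> / 2 * (64 * \<kappa> + 3) - \<gamma> / (64 * real n))
        - 3 / 5 / scale * (\<gamma> / 2 * (64 * \<kappa> + 3)) + 3 / 5 / scale * (\<gamma> / (64 * real n))"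
    unfolding rate_def left_diff_distrib right_diff_distrib by simp
  moreover have "3 / 5 / scale * (\<gamma> / 2 * (64 * \<kappa> + 3)) = 3 / 10 * \<gamma> * ((64 * \<kappa> + 3) / scale)"
    by simp
  moreover have "\<gamma> / (64 * real n) = 1 / 64 * (\<gamma> / real n)" by simp
  moreover have "3 / 10 * \<gamma> * (3 / real n) = 9 / 10 * (\<gamma> / real n)" by simp
  moreover have "\<gamma> / real n > 0" using pos n0 by simp
  ultimately show ?thesis by linarith
qed

text \<open>In terms of \<open>t = 64 * \<kappa>\<close> the error coefficient
  \<open>8 * \<kappa>\<close> is \<open>t / 8\<close>, and the weight \<open>\<gamma> / 8\<close> of
  the outside term is chosen to match it for large \<open>t\<close>. The 2/5 is what remains of 1
  after the 3/5 in \<open>rate\<close>.\<close>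

lemma rate_outside:
  "(\<gamma> / 8 * (64 * \<kappa> + 3) + \<gamma> * \<kappa> / real n * (8 + 4 / (64 * \<kappa> + 1))) * (1 - 1 / real n)
    \<le> rate * (\<gamma> / 8 * (64 * \<kappa> + 3))"
proof -
  define t where "t = 64 * \<kappa>"
  have t: "t \<ge> 0" using \<kappa>_nonneg by (simp add: t_def)
  have n0: "real n > 0" using n by simp
  let ?e = "\<gamma> * \<kappa> / real n * (8 + 4 / (t + 1))"
  have e: "?e = \<gamma> / real n / (t + 1) * (t * (8 * t + 12) / 64)"
  proof -
    have "\<kappa> = t / 64" by (simp add: t_def)
    then show ?thesis using t n0 by (simp only:) (simp add: field_simps)
  qed
  have "t * (8 * t + 12) / 64 \<le> (t + 3) / 8 * (t + 2 / 5)"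
    using t by (simp add: field_simps)
  then have "?e \<le> \<gamma> / real n / (t + 1) * ((t + 3) / 8 * (t + 2 / 5))"
    unfolding e using pos t by (intro mult_left_mono) auto
  also have "\<dots> = \<gamma> / 8 * (t + 3) * ((t + 2 / 5) / (real n * (t + 1)))" using t n0 by (simp add: field_simps)
  also have "\<dots> \<le> \<gamma> / 8 * (t + 3) * (1 / real n - 3 / 5 / scale)"
  proof -
    have "real n * (t + 1) \<le> scale" by (simp add: scale_def t_def)
    then have "3 / 5 / scale \<le> 3 / 5 / (real n * (t + 1))"
      using n0 t scale_gt(2) by (intro divide_left_mono mult_pos_pos) auto
    moreover have "1 / real n - 3 / 5 / (real n * (t + 1)) = (t + 2 / 5) / (real n * (t + 1))"
    proof -
      have "1 / real n = (t + 1) / (real n * (t + 1))" using t n0 by simp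
      then show ?thesis by (simp only: diff_divide_distrib[symmetric]) simp
    qed
    ultimately have "(t + 2 / 5) / (real n * (t + 1)) \<le> 1 / real n - 3 / 5 / scale" by linarith
    then show ?thesis using pos t by (intro mult_left_mono) auto
  qed
  finally have 1: "?e \<le> \<gamma> / 8 * (t + 3) * (1 / real n - 3 / 5 / scale)" .
  have 2: "?e * (1 - 1 / real n) \<le> ?e"
    using n pos \<kappa>_nonneg t by (intro mult_left_le) auto
  have "(c + e) * (1 - 1 / real n) \<le> (1 - 3 / 5 / scale) * c"
    if "e \<le> c * (1 / real n - 3 / 5 / scale)" "e * (1 - 1 / real n) \<le> e" for c e
    using that by (simp add: algebra_simps add_divide_distrib)
  from this[OF 1 2] show ?thesis unfolding t_def rate_def .
qed

text \<open>78.8 and 1.3 are above 64 * 1.23 = 78.72 and 1.23, so \<open>M\<close> is at least 1.23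
  times \<open>scale\<close>; the resulting exponent 0.6 * 1.23 = 0.738 exceeds
  \<open>ln 2\<close>.\<close>

lemma rate_power_le:
  assumes "real M \<ge> 78.8 * real n * \<kappa> + 1.3 * real n + 1.3"
  shows "rate ^ M \<le> 1 / 2"
proof -
  define X where "X = real n * \<kappa>"
  have "X \<ge> 0" using \<kappa>_nonneg by (simp add: X_def)
  moreover have "real M \<ge> 78.8 * X + 1.3 * real n + 1.3" using assms by (simp add: X_def)
  moreover have "real n \<ge> 0" by simp
  ultimately have "real M \<ge> 123 / 100 * scale"
    unfolding scale_eq X_def[symmetric] ring_distribs by linarith
  then have M: "3 / 5 / scale * real M \<ge> 3 / 5 / scale * (123 / 100 * scale)"
    using scale_gt by (intro mult_left_mono) auto
  have "rate ^ M \<le> exp (- (3 / 5 / scale)) ^ M"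
    using rate_bounds exp_ge_add_one_self[of "- (3 / 5 / scale)"] by (intro power_mono) (auto simp: rate_def)
  also have "\<dots> = exp (- (3 / 5 / scale * real M))"
    by (simp add: exp_of_nat_mult[symmetric] mult.commute)
  also have "\<dots> \<le> exp (- ln 2)"
    using M scale_gt ln2_le_25_over_36 by simp
  finally show ?thesis by (simp add: exp_minus)
qed

text \<open>In the sum of the two averaged progress bounds \<open>C'\<close> occurs with both signs.
  The primal drift is measured at the updated dual vector, so it has to be subtracted on the left;
  this is the origin of the correction \<open>\<gamma> / (64 * real n)\<close>.\<close>

lemma potential_step:
  "avg (\<lambda>i j. avg (\<lambda>i' j'. potential (primal_step \<theta>t \<theta> (dual_step \<theta>t \<theta> w i j) i' j') (dual_step \<theta>t \<theta> w i j)))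
    \<le> rate * potential \<theta> w + \<mu> / 32 * (norm (\<theta>t - \<theta>s))\<^sup>2"
proof -
  define a A b where "a = (norm (\<theta> - \<theta>s))\<^sup>2" and "A = (norm (\<theta>t - \<theta>s))\<^sup>2" and "b = (norm (\<theta> - \<theta>t))\<^sup>2"
  define k1 k2 where "k1 = Bf\<^sup>2 / (\<gamma> * \<mu>)" and "k2 = Bw\<^sup>2 * B\<theta>\<^sup>2 / \<mu>\<^sup>2"
  define t where "t = 64 * \<kappa>"
  let ?w = "dual_step \<theta>t \<theta> w"
  define S where "S = avg (\<lambda>i j. avg (\<lambda>i' j'. (norm (primal_step \<theta>t \<theta> (?w i j) i' j' - \<theta>s))\<^sup>2))"
  define D' where "D' = avg (\<lambda>i j. dist_sq (?w i j))"
  define O' where "O' = avg (\<lambda>i j. outside_sq (?w i j))"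
  define C' where "C' = avg (\<lambda>i j. coupling \<theta> (?w i j))"
  have n0: "real n > 0" "real n \<ge> 1" using n by auto
  have k: "k1 \<ge> 0" "k2 \<ge> 0" "\<kappa> = k1 + k2" using pos by (simp_all add: k1_def k2_def \<kappa>)
  have t: "t \<ge> 0" using \<kappa>_nonneg by (simp add: t_def)
  have nonneg: "a \<ge> 0" "A \<ge> 0" "b \<ge> 0" by (simp_all add: a_def A_def b_def)
  have S0: "S \<ge> 0" unfolding S_def by (intro avg_nonneg zero_le_power2)
  have D0: "D' \<ge> 0" unfolding D'_def by (intro avg_nonneg dist_sq_nonneg)
  have O': "O' = (1 - 1 / real n) * outside_sq w"
    unfolding O'_def by (rule outside_progress)
  have O0: "O' \<ge> 0" unfolding O' using n0 outside_sq_nonneg by simp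
  \<comment> \<open>This gives \<open>b + a \<le> 3 * a + 2 * A\<close>, the source of the
    coefficients 3/64 and 1/32 of \<mu>.\<close>
  have b: "b \<le> 2 * a + 2 * A"
    using norm_add_sq_le[of "\<theta> - \<theta>s" "\<theta>s - \<theta>t"] by (simp add: a_def b_def A_def norm_minus_commute)
  define q where "q = t + 1"
  have q: "q > 0" using t by (simp add: q_def)
  have \<alpha>: "\<alpha>\<theta> = 1 / (real n * \<mu> * q)" "\<alpha>w = 1 / (\<gamma> * q)"
    using n0 pos by (simp_all add: \<alpha>\<theta> \<alpha>w q_def t_def)
  have c1: "1 / (2 * \<alpha>\<theta>) = \<mu> / 2 * (scale - 1)"
    by (simp add: \<alpha>\<theta> scale_def)
  have c2: "1 / (2 * \<alpha>w) = \<gamma> / 2 * (t + 1)"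
    by (simp add: \<alpha> q_def)
  have c3: "\<alpha>\<theta> * (B\<theta> * Bw)\<^sup>2 = \<mu> * (k2 / (t + 1)) / real n"
    unfolding \<alpha> k2_def q_def[symmetric] using pos q n0 by (simp add: power2_eq_square field_simps)
  have c4: "\<alpha>\<theta> * Bf\<^sup>2 = \<gamma> * (k1 / (t + 1)) / real n"
    unfolding \<alpha> k1_def q_def[symmetric] using pos q n0 by (simp add: field_simps)
  have c5: "\<alpha>w / 2 * Bf\<^sup>2 = \<mu> * (k1 / (t + 1)) / 2"
    unfolding \<alpha> k1_def q_def[symmetric] using pos q n0 by (simp add: field_simps)
  have c6: "8 * Bf\<^sup>2 / \<mu> = 8 * \<gamma> * k1"
    using pos by (simp add: k1_def)
  have primal: "(1 / (2 * \<alpha>\<theta>) + \<mu>) * S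
    \<le> ((1 / (2 * \<alpha>\<theta>) + \<mu> / 8) * a + \<alpha>\<theta> * (B\<theta> * Bw)\<^sup>2 * (b + a)) - C'
      + \<alpha>\<theta> * Bf\<^sup>2 / real n * (4 * O') + \<alpha>\<theta> * Bf\<^sup>2 / real n * D' + 8 * Bf\<^sup>2 / \<mu> / real n * O'"
  proof -
    have "(1 / (2 * \<alpha>\<theta>) + \<mu>) * avg (\<lambda>i' j'. (norm (primal_step \<theta>t \<theta> (?w i j) i' j' - \<theta>s))\<^sup>2)
      \<le> ((1 / (2 * \<alpha>\<theta>) + \<mu> / 8) * a + \<alpha>\<theta> * (B\<theta> * Bw)\<^sup>2 * (b + a)) - coupling \<theta> (?w i j)
        + \<alpha>\<theta> * Bf\<^sup>2 / real n * (4 * outside_sq (?w i j)) + \<alpha>\<theta> * Bf\<^sup>2 / real n * dist_sq (?w i j)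
        + 8 * Bf\<^sup>2 / \<mu> / real n * outside_sq (?w i j)" for i j
    proof -
      have eq: "\<alpha>\<theta> * Bf\<^sup>2 * (4 * u + v) / real n = \<alpha>\<theta> * Bf\<^sup>2 / real n * (4 * u) + \<alpha>\<theta> * Bf\<^sup>2 / real n * v"
        "8 * Bf\<^sup>2 / \<mu> * u / real n = 8 * Bf\<^sup>2 / \<mu> / real n * u" for u v
        by (simp_all add: ring_distribs add_divide_distrib)
      then show ?thesis
        using primal_progress[of \<theta>t \<theta> "?w i j"] unfolding eq a_def b_def by linarith
    qed
    from avg_mono[OF this] show ?thesis
      unfolding S_def C'_def O'_def D'_def by (simp only: avg_mult_left avg_add avg_diff avg_const)
  qed
  have dual: "(1 / (2 * \<alpha>w) + \<gamma>) * D' \<le> (1 / (2 * \<alpha>w) + \<gamma> - \<gamma> / real n) * dist_sq w + C'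
      + \<alpha>w / 2 * Bf\<^sup>2 * (b + a)"
    unfolding a_def b_def C'_def D'_def by (rule dual_progress)
  \<comment> \<open>The factor 64 in the step sizes pays off here: \<open>k1 + k2\<close> is
    \<kappa> and \<open>t\<close> is \<open>64 * \<kappa>\<close>.\<close>
  have s: "(k1 + k2) / (t + 1) \<le> 1 / 64" using k t by (simp add: t_def field_simps)
  have s1: "k1 / (t + 1) \<ge> 0" "k2 / (t + 1) \<ge> 0" using k t by auto
  have noise: "\<alpha>\<theta> * (B\<theta> * Bw)\<^sup>2 * (b + a) + \<alpha>w / 2 * Bf\<^sup>2 * (b + a) \<le> \<mu> / 64 * (3 * a + 2 * A)"
  proof -
    have "\<mu> * (k2 / (t + 1)) / real n \<le> \<mu> * (k2 / (t + 1)) / 1"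
      using n0 s1 pos by (intro divide_left_mono mult_nonneg_nonneg) auto
    moreover have "\<mu> * (k1 / (t + 1)) / 2 \<le> \<mu> * (k1 / (t + 1)) / 1"
      using s1 pos by (intro divide_left_mono mult_nonneg_nonneg) auto
    ultimately have "\<mu> * (k2 / (t + 1)) / real n + \<mu> * (k1 / (t + 1)) / 2
        \<le> \<mu> * (k2 / (t + 1)) / 1 + \<mu> * (k1 / (t + 1)) / 1" by (rule add_mono)
    also have "\<dots> = \<mu> * ((k1 + k2) / (t + 1))"
      by (simp only: add_divide_distrib distrib_left div_by_1 add.commute)
    also have "\<dots> \<le> \<mu> * (1 / 64)"
      using s pos by (intro mult_left_mono) auto
    finally have "\<mu> * (k2 / (t + 1)) / real n + \<mu> * (k1 / (t + 1)) / 2 \<le> \<mu> / 64" by simp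
    moreover have "b + a \<le> 3 * a + 2 * A" using b by simp
    ultimately have "(\<mu> * (k2 / (t + 1)) / real n + \<mu> * (k1 / (t + 1)) / 2) * (b + a)
        \<le> \<mu> / 64 * (3 * a + 2 * A)"
      using nonneg pos by (intro mult_mono) auto
    then show ?thesis unfolding c3 c5 by (simp add: ring_distribs)
  qed
  have small: "\<alpha>\<theta> * Bf\<^sup>2 / real n * D' \<le> \<gamma> / (64 * real n) * D'"
  proof -
    have "k1 / (t + 1) \<le> (k1 + k2) / (t + 1)"
      using k t by (intro divide_right_mono) auto
    with s have "k1 / (t + 1) \<le> 1 / 64" by (rule order_trans[rotated])
    then have "\<gamma> * (k1 / (t + 1)) \<le> \<gamma> * (1 / 64)" using pos by (intro mult_left_mono) auto
    then have "\<gamma> * (k1 / (t + 1)) / real n \<le> \<gamma> * (1 / 64) / 1"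
      using n0 pos by (intro frac_le) auto
    then have "\<alpha>\<theta> * Bf\<^sup>2 / real n \<le> \<gamma> / 64 / real n"
      unfolding c4 using n0 by (intro divide_right_mono) auto
    then show ?thesis using D0 by (intro mult_right_mono) auto
  qed
  have outside: "\<alpha>\<theta> * Bf\<^sup>2 / real n * (4 * O') + 8 * Bf\<^sup>2 / \<mu> / real n * O'
      \<le> \<gamma> * \<kappa> / real n * (8 + 4 / (t + 1)) * O'"
  proof -
    have "\<gamma> * (k1 / (t + 1)) \<le> \<gamma> * (\<kappa> / (t + 1))"
      using pos k t by (intro mult_left_mono divide_right_mono) auto
    then have "\<gamma> * (k1 / (t + 1)) / real n \<le> \<gamma> * (\<kappa> / (t + 1)) / 1"
      using n0 pos t \<kappa>_nonneg by (intro frac_le mult_nonneg_nonneg divide_nonneg_nonneg) auto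
    then have "\<gamma> * (k1 / (t + 1)) / real n * 4 + 8 * \<gamma> * k1 \<le> \<gamma> * (\<kappa> / (t + 1)) * 4 + 8 * \<gamma> * \<kappa>"
      using k pos by (intro add_mono mult_left_mono mult_right_mono) auto
    then have "(\<gamma> * (k1 / (t + 1)) / real n * 4 + 8 * \<gamma> * k1) * (O' / real n)
        \<le> (\<gamma> * (\<kappa> / (t + 1)) * 4 + 8 * \<gamma> * \<kappa>) * (O' / real n)"
      using O0 n0 by (intro mult_right_mono) auto
    then show ?thesis unfolding c4 c6 by (simp add: ring_distribs add_divide_distrib mult_ac)
  qed
  have "avg (\<lambda>i j. avg (\<lambda>i' j'. potential (primal_step \<theta>t \<theta> (?w i j) i' j') (?w i j)))
      = \<mu> / 2 * scale * S + (\<gamma> / 2 * (t + 3) - \<gamma> / (64 * real n)) * D' + \<gamma> / 8 * (t + 3) * O'"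
    unfolding potential_def S_def D'_def O'_def t_def by (simp only: avg_add avg_mult_left avg_const)
  also have "\<dots> \<le> (1 / (2 * \<alpha>\<theta>) + \<mu>) * S + (1 / (2 * \<alpha>w) + \<gamma>) * D' - \<gamma> / (64 * real n) * D' + \<gamma> / 8 * (t + 3) * O'"
  proof -
    \<comment> \<open>The available weight is \<open>\<mu> / 2 * (scale + 1)\<close>; lowering it
      matches the Lyapunov function.\<close>
    have "\<mu> / 2 * scale \<le> 1 / (2 * \<alpha>\<theta>) + \<mu>" unfolding c1 using pos by (simp add: field_simps)
    then have "\<mu> / 2 * scale * S \<le> (1 / (2 * \<alpha>\<theta>) + \<mu>) * S" using S0 by (rule mult_right_mono)
    moreover have "\<gamma> / 2 * (t + 3) = 1 / (2 * \<alpha>w) + \<gamma>" unfolding c2 by (simp add: field_simps)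
    ultimately show ?thesis by (simp only: left_diff_distrib)
  qed
  also have "\<dots> \<le> (\<mu> / 2 * (scale - 1) + (\<mu> / 8 + 3 / 64 * \<mu>)) * a
      + (\<gamma> / 2 * (t + 3) - \<gamma> / real n) * dist_sq w
      + (\<gamma> / 8 * (t + 3) + \<gamma> * \<kappa> / real n * (8 + 4 / (t + 1))) * O' + \<mu> / 32 * A"
  proof -
    have "\<mu> / 64 * (3 * a + 2 * A) = 3 / 64 * \<mu> * a + \<mu> / 32 * A" by (simp add: algebra_simps)
    moreover have "(1 / (2 * \<alpha>w) + \<gamma> - \<gamma> / real n) * dist_sq w
        = (\<gamma> / 2 * (t + 3) - \<gamma> / real n) * dist_sq w"
      unfolding c2 by (simp add: algebra_simps)
    moreover have "(\<mu> / 2 * (scale - 1) + (\<mu> / 8 + 3 / 64 * \<mu>)) * a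
        = (1 / (2 * \<alpha>\<theta>) + \<mu> / 8) * a + 3 / 64 * \<mu> * a"
      unfolding c1 by (simp add: algebra_simps)
    moreover have "(\<gamma> / 8 * (t + 3) + \<gamma> * \<kappa> / real n * (8 + 4 / (t + 1))) * O'
        = \<gamma> / 8 * (t + 3) * O' + \<gamma> * \<kappa> / real n * (8 + 4 / (t + 1)) * O'"
      by (rule distrib_right)
    ultimately show ?thesis using primal dual noise small outside by linarith
  qed
  also have "\<dots> \<le> rate * (\<mu> / 2 * scale) * a
      + rate * (\<gamma> / 2 * (t + 3) - \<gamma> / (64 * real n)) * dist_sq w
      + rate * (\<gamma> / 8 * (t + 3)) * outside_sq w + \<mu> / 32 * A"
  proof -
    have "(\<gamma> / 8 * (t + 3) + \<gamma> * \<kappa> / real n * (8 + 4 / (t + 1))) * O'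
        = (\<gamma> / 8 * (t + 3) + \<gamma> * \<kappa> / real n * (8 + 4 / (t + 1))) * (1 - 1 / real n) * outside_sq w"
      by (simp add: O')
    also have "\<dots> \<le> rate * (\<gamma> / 8 * (t + 3)) * outside_sq w"
      using rate_outside outside_sq_nonneg unfolding t_def by (intro mult_right_mono)
    finally show ?thesis
      using rate_primal rate_dual nonneg dist_sq_nonneg unfolding t_def
      by (intro add_mono mult_right_mono) auto
  qed
  also have "\<dots> = rate * potential \<theta> w + \<mu> / 32 * (norm (\<theta>t - \<theta>s))\<^sup>2"
    unfolding potential_def a_def A_def t_def by (simp add: algebra_simps)
  finally show ?thesis .
qed

lemma lyapunov_scaled:
  "\<mu> / 2 * scale * lyapunov \<theta> w = \<mu> / 2 * scale * (norm (\<theta> - \<theta>s))\<^sup>2 + \<gamma> / 2 * (64 * \<kappa> + 3) * dist_sq w"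
proof -
  have "64 * real n * \<kappa> + real n + 1 = scale" by (simp add: scale_def algebra_simps)
  then show ?thesis
    using pos scale_gt(2) unfolding lyapunov_def by (simp add: field_simps)
qed

text \<open>1/96 is the quotient of the largest correction \<open>\<gamma> / 64\<close> and the
  smallest dual weight \<open>3 * \<gamma> / 2\<close>.\<close>

lemma lyapunov_le_potential: "95 / 96 * (\<mu> / 2 * scale * lyapunov \<theta> w) \<le> potential \<theta> w"
proof -
  have "\<gamma> / (64 * real n) \<le> \<gamma> / 64"
    using pos n by (intro divide_left_mono) auto
  moreover have "1 / 96 * (\<gamma> / 2 * (64 * \<kappa> + 3)) \<ge> \<gamma> / 64"
    using pos \<kappa>_nonneg by (simp add: field_simps)
  ultimately have "95 / 96 * (\<gamma> / 2 * (64 * \<kappa> + 3)) \<le> \<gamma> / 2 * (64 * \<kappa> + 3) - \<gamma> / (64 * real n)"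
    by linarith
  then have "95 / 96 * (\<gamma> / 2 * (64 * \<kappa> + 3)) * dist_sq w
      \<le> (\<gamma> / 2 * (64 * \<kappa> + 3) - \<gamma> / (64 * real n)) * dist_sq w"
    using dist_sq_nonneg by (rule mult_right_mono)
  moreover have "95 / 96 * (\<mu> / 2 * scale * (norm (\<theta> - \<theta>s))\<^sup>2) \<le> \<mu> / 2 * scale * (norm (\<theta> - \<theta>s))\<^sup>2"
    using pos scale_gt by simp
  moreover have "\<gamma> / 8 * (64 * \<kappa> + 3) * outside_sq w \<ge> 0"
    using pos \<kappa>_nonneg outside_sq_nonneg by simp
  ultimately show ?thesis unfolding lyapunov_scaled potential_def by (simp add: ring_distribs)
qed

text \<open>The 1/2 anticipates \<open>rate ^ M\<close>, and division by \<open>1 - rate\<close>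
  sums the errors of the reference point to 5/48 of the primal part; 1/2 + 5/48 is below 5/8.
  Bounding \<open>outside_sq\<close> by \<open>dist_sq\<close> raises the dual part to at most 5/4,
  half of which is 5/8. Since this bound is taken anew in every stage, nothing about the domain is
  carried from one stage to the next.\<close>

lemma potential_initial:
  "1 / 2 * potential \<theta> w + \<mu> / 32 * (norm (\<theta> - \<theta>s))\<^sup>2 / (1 - rate) \<le> 5 / 8 * (\<mu> / 2 * scale * lyapunov \<theta> w)"
proof -
  define a b where "a = \<mu> / 2 * scale * (norm (\<theta> - \<theta>s))\<^sup>2" and "b = \<gamma> / 2 * (64 * \<kappa> + 3) * dist_sq w"
  have 1: "\<mu> / 32 * (norm (\<theta> - \<theta>s))\<^sup>2 / (1 - rate) = 5 / 48 * a"
    using scale_gt(2) by (simp add: rate_def a_def field_simps)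
  have 2: "\<mu> / 2 * scale * lyapunov \<theta> w = a + b" unfolding lyapunov_scaled a_def b_def ..
  have "\<gamma> / 8 * (64 * \<kappa> + 3) * outside_sq w \<le> \<gamma> / 8 * (64 * \<kappa> + 3) * dist_sq w"
    using pos \<kappa>_nonneg outside_sq_le by (intro mult_left_mono) auto
  also have "\<dots> = 1 / 4 * b" by (simp add: b_def)
  finally have 3: "\<gamma> / 8 * (64 * \<kappa> + 3) * outside_sq w \<le> 1 / 4 * b" .
  have "\<gamma> / (64 * real n) * dist_sq w \<ge> 0" using pos dist_sq_nonneg by simp
  with 3 have "potential \<theta> w \<le> a + 5 / 4 * b"
    unfolding potential_def a_def[symmetric] left_diff_distrib b_def[symmetric] by linarith
  moreover have "a \<ge> 0" using pos scale_gt(2) by (simp add: a_def)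
  ultimately show ?thesis unfolding 1 2 by (simp add: algebra_simps)
qed

end

section \<open>Finite random iterations\<close>

lemma set_sample_index:
  assumes "n \<ge> 1" "\<And>i. i < n \<Longrightarrow> nY i \<ge> 1"
  shows "set_pmf (sample_index n nY) = Sigma {..<n} (\<lambda>i. {..<nY i})" "finite (set_pmf (sample_index n nY))"
proof -
  have ne: "{..<m} \<noteq> {}" if "m \<ge> 1" for m :: nat using that by (metis lessThan_empty_iff not_one_le_zero)
  show "set_pmf (sample_index n nY) = Sigma {..<n} (\<lambda>i. {..<nY i})"
    unfolding sample_index_def using assms ne by (auto simp: set_pmf_of_set)
  then show "finite (set_pmf (sample_index n nY))" by simp
qed

lemma expectation_sample_index_bind:
  fixes h :: "'s \<Rightarrow> real"
  assumes "n \<ge> 1" "\<And>i. i < n \<Longrightarrow> nY i \<ge> 1" "\<And>i j. finite (set_pmf (K (i, j)))"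
  shows "measure_pmf.expectation (bind_pmf (sample_index n nY) K) h
    = mean n (\<lambda>i. mean (nY i) (\<lambda>j. measure_pmf.expectation (K (i, j)) h))"
proof -
  have ne: "{..<m} \<noteq> {}" if "m \<ge> 1" for m :: nat using that by (metis lessThan_empty_iff not_one_le_zero)
  have "bind_pmf (sample_index n nY) K
      = bind_pmf (pmf_of_set {..<n}) (\<lambda>i. bind_pmf (pmf_of_set {..<nY i}) (\<lambda>j. K (i, j)))"
    unfolding sample_index_def by (simp add: bind_assoc_pmf bind_return_pmf)
  also have "measure_pmf.expectation \<dots> h = (\<Sum>i<n. measure_pmf.expectation
      (bind_pmf (pmf_of_set {..<nY i}) (\<lambda>j. K (i, j))) h /\<^sub>R real (card {..<n}))"
    using assms ne by (intro pmf_expectation_bind_pmf_of_set) (auto simp: set_pmf_of_set)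
  also have "\<dots> = (\<Sum>i<n. mean (nY i) (\<lambda>j. measure_pmf.expectation (K (i, j)) h) /\<^sub>R real n)"
  proof (intro sum.cong refl)
    fix i assume "i \<in> {..<n}"
    then have "measure_pmf.expectation (bind_pmf (pmf_of_set {..<nY i}) (\<lambda>j. K (i, j))) h
        = (\<Sum>j<nY i. measure_pmf.expectation (K (i, j)) h /\<^sub>R real (card {..<nY i}))"
      using assms ne by (intro pmf_expectation_bind_pmf_of_set) auto
    then show "measure_pmf.expectation (bind_pmf (pmf_of_set {..<nY i}) (\<lambda>j. K (i, j))) h /\<^sub>R real (card {..<n})
        = mean (nY i) (\<lambda>j. measure_pmf.expectation (K (i, j)) h) /\<^sub>R real n"
      by (simp add: mean_def sum_divide_distrib divide_inverse mult.commute sum_distrib_left)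
  qed
  finally show ?thesis by (simp add: mean_def sum_distrib_left divide_inverse mult.commute)
qed

lemma expectation_mono_finite:
  fixes h k :: "'s \<Rightarrow> real"
  assumes "finite (set_pmf p)" "\<And>x. x \<in> set_pmf p \<Longrightarrow> h x \<le> k x"
  shows "measure_pmf.expectation p h \<le> measure_pmf.expectation p k"
  using assms by (intro integral_mono_AE integrable_measure_pmf_finite) (auto simp: AE_measure_pmf_iff)

lemma expectation_bind_finite:
  fixes h :: "'s \<Rightarrow> real"
  assumes "finite (set_pmf p)" "\<And>x. x \<in> set_pmf p \<Longrightarrow> finite (set_pmf (K x))"
  shows "measure_pmf.expectation (bind_pmf p K) h = measure_pmf.expectation p (\<lambda>x. measure_pmf.expectation (K x) h)"
  using assms pmf_expectation_bind[of "set_pmf p" K p h]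
    integral_measure_pmf[of "set_pmf p" p "\<lambda>x. measure_pmf.expectation (K x) h"] by simp

lemma finite_set_iterate_pmf:
  assumes "\<And>x. finite (set_pmf (K x))"
  shows "finite (set_pmf (iterate_pmf K k x))"
  by (induction k) (simp_all add: assms)

lemma set_iterate_pmf_invariant:
  assumes "x \<in> I" "\<And>x. x \<in> I \<Longrightarrow> set_pmf (K x) \<subseteq> I"
  shows "set_pmf (iterate_pmf K k x) \<subseteq> I"
  by (induction k) (use assms in auto)

lemma iterate_pmf_counter:
  fixes c :: "'s \<Rightarrow> nat"
  assumes "\<And>x y. y \<in> set_pmf (K x) \<Longrightarrow> c y = c x + d" "y \<in> set_pmf (iterate_pmf K k x)"
  shows "c y = c x + k * d"
  using assms(2) by (induction k arbitrary: y) (use assms(1) in fastforce)+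

text \<open>For the inner iteration, \<open>I\<close> records that \<open>U\<close> is the gradient
  at the reference point, the relation under which the drift bound is established.\<close>

lemma iterate_pmf_drift:
  fixes h :: "'s \<Rightarrow> real"
  assumes fin: "\<And>x. finite (set_pmf (K x))"
    and inv: "x0 \<in> I" "\<And>x. x \<in> I \<Longrightarrow> set_pmf (K x) \<subseteq> I"
    and drift: "\<And>x. x \<in> I \<Longrightarrow> measure_pmf.expectation (K x) h \<le> r * h x + c"
    and r: "0 \<le> r"
  shows "measure_pmf.expectation (iterate_pmf K k x0) h \<le> r ^ k * h x0 + c * (\<Sum>i<k. r ^ i)"
proof (induction k)
  case (Suc k)
  let ?p = "iterate_pmf K k x0"
  have fp: "finite (set_pmf ?p)" by (rule finite_set_iterate_pmf[OF fin])
  have "measure_pmf.expectation (iterate_pmf K (Suc k) x0) h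
      = measure_pmf.expectation ?p (\<lambda>x. measure_pmf.expectation (K x) h)"
    by (simp add: expectation_bind_finite[OF fp fin])
  also have "\<dots> \<le> measure_pmf.expectation ?p (\<lambda>x. r * h x + c)"
    using set_iterate_pmf_invariant[of x0 I K k, OF inv] by (intro expectation_mono_finite fp drift) blast
  also have "\<dots> = r * measure_pmf.expectation ?p h + c"
    using integrable_measure_pmf_finite[OF fp, of h] by simp
  also have "\<dots> \<le> r * (r ^ k * h x0 + c * (\<Sum>i<k. r ^ i)) + c"
    using Suc.IH r by (intro add_right_mono mult_left_mono)
  also have "\<dots> = r ^ Suc k * h x0 + c * (\<Sum>i<Suc k. r ^ i)"
  proof -
    have "(\<Sum>i<Suc k. r ^ i) = 1 + r * (\<Sum>i<k. r ^ i)"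
      unfolding sum.lessThan_Suc_shift by (simp add: sum_distrib_left)
    then show ?thesis by (simp add: algebra_simps)
  qed
  finally show ?case .
qed simp

section \<open>Convergence of SVRPDA-I\<close>

lemma GDERIV_mean:
  assumes "\<And>i. i < m \<Longrightarrow> GDERIV (h i) u :> D i"
  shows "GDERIV (\<lambda>v. mean m (\<lambda>i. h i v)) u :> mean m D"
proof -
  have "((\<lambda>v. \<Sum>i<m. h i v) has_derivative (\<lambda>v. \<Sum>i<m. v \<bullet> D i)) (at u)"
    using assms unfolding gderiv_def by (intro has_derivative_sum) auto
  from has_derivative_scaleR_right[OF this, of "1 / real m"] show ?thesis
    unfolding gderiv_def mean_def by (simp add: inner_sum_right)
qed

lemma fbar_eq_mean: "fbar nY x y f \<theta> i = mean (nY i) (\<lambda>j. f \<theta> (x i) (y i j))"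
  by (simp add: fbar_def mean_def)

lemma fbar_prime_mult_vec:
  fixes f :: "real^'d \<Rightarrow> real^'mx \<Rightarrow> real^'my \<Rightarrow> real^'l"
  shows "fbar_prime nY x y f \<theta> i *v v = mean (nY i) (\<lambda>j. fprime f \<theta> (x i) (y i j) *v v)"
proof -
  have "(\<Sum>j<m. A j) *v v = (\<Sum>j<m. A j *v v)" for m and A :: "nat \<Rightarrow> real^'l^'d" and v
    by (induction m) (simp_all add: matrix_vector_mult_add_rdistrib)
  then show ?thesis by (simp add: fbar_prime_def mean_def scaleR_matrix_vector_assoc[symmetric])
qed

text \<open>On the domain the conjugates are real constants with respect to \<theta>, so gradients
  of the Lagrangian in \<theta> come from the bilinear part alone.\<close>

lemma lagrangian_finite:
  assumes "\<And>i. i < nX \<Longrightarrow> convex_conjugate (\<phi> i) (w i) < \<infinity>"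
  shows "lagrangian nX nY x y f \<phi> \<theta> w
    = ereal (mean nX (\<lambda>i. fbar nY x y f \<theta> i \<bullet> w i - real_of_ereal (convex_conjugate (\<phi> i) (w i))))"
proof -
  have "ereal (fbar nY x y f \<theta> i \<bullet> w i) - convex_conjugate (\<phi> i) (w i)
      = ereal (fbar nY x y f \<theta> i \<bullet> w i - real_of_ereal (convex_conjugate (\<phi> i) (w i)))" if "i < nX" for i
    using assms[OF that] conjugate_ge[of 0 "w i" "\<phi> i"]
    by (cases "convex_conjugate (\<phi> i) (w i)") auto
  then have "(\<Sum>i<nX. ereal (fbar nY x y f \<theta> i \<bullet> w i) - convex_conjugate (\<phi> i) (w i))
      = ereal (\<Sum>i<nX. fbar nY x y f \<theta> i \<bullet> w i - real_of_ereal (convex_conjugate (\<phi> i) (w i)))"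
    by (simp del: ereal_minus)
  then show ?thesis unfolding lagrangian_def mean_def by simp
qed

locale svrpda_problem =
  fixes nX :: nat and nY :: "nat \<Rightarrow> nat"
    and x :: "nat \<Rightarrow> real^'mx" and y :: "nat \<Rightarrow> nat \<Rightarrow> real^'my"
    and f :: "real^'d \<Rightarrow> real^'mx \<Rightarrow> real^'my \<Rightarrow> real^'l"
    and \<phi> :: "nat \<Rightarrow> real^'l \<Rightarrow> real" and g :: "real^'d \<Rightarrow> real"
    and \<mu> \<gamma> Bw B\<theta> Bf \<kappa> \<alpha>\<theta> \<alpha>w :: real
    and \<theta>s :: "real^'d" and ws :: "nat \<Rightarrow> real^'l"
  assumes nX_ge: "nX \<ge> 1" and nY_ge: "\<And>i. i < nX \<Longrightarrow> nY i \<ge> 1"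
    and f_diff: "\<And>\<theta> a b. (\<lambda>\<eta>. f \<eta> a b) differentiable (at \<theta>)"
    and \<phi>_nonneg: "\<And>i u. i < nX \<Longrightarrow> \<phi> i u \<ge> 0"
    and \<phi>_convex: "\<And>i. i < nX \<Longrightarrow> convex_on UNIV (\<phi> i)"
    and g_convex: "convex_on UNIV g"
    and saddle: "saddle_point nX nY x y f \<phi> g \<theta>s ws"
    and constants_pos: "\<mu> > 0" "\<gamma> > 0" "Bw > 0" "B\<theta> > 0" "Bf > 0"
    and g_strongly_convex: "strongly_convex \<mu> g"
    and \<phi>_smooth: "\<And>i. i < nX \<Longrightarrow> smooth_function (1 / \<gamma>) (\<phi> i)"
    and \<phi>_lip: "\<And>i u u'. i < nX \<Longrightarrow> \<bar>\<phi> i u - \<phi> i u'\<bar> \<le> Bw * norm (u - u')"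
    and fprime_lip: "\<And>i j \<theta>1 \<theta>2. i < nX \<Longrightarrow> j < nY i \<Longrightarrow>
               onorm (\<lambda>v. (fprime f \<theta>1 (x i) (y i j) - fprime f \<theta>2 (x i) (y i j)) *v v)
                 \<le> B\<theta> * norm (\<theta>1 - \<theta>2)"
    and fprime_bound: "\<And>i j \<theta>. i < nX \<Longrightarrow> j < nY i \<Longrightarrow>
               onorm (\<lambda>v. fprime f \<theta> (x i) (y i j) *v v) \<le> Bf"
    and lagrangian_convex: "\<And>w \<theta>1 \<theta>2. (\<And>i. i < nX \<Longrightarrow> convex_conjugate (\<phi> i) (w i) < \<infinity>) \<Longrightarrow>
               lagrangian nX nY x y f \<phi> \<theta>1 w - lagrangian nX nY x y f \<phi> \<theta>2 w
                 \<ge> ereal (grad (\<lambda>\<theta>. real_of_ereal (lagrangian nX nY x y f \<phi> \<theta> w)) \<theta>2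
                            \<bullet> (\<theta>1 - \<theta>2))"
    and \<kappa>_eq: "\<kappa> = Bf\<^sup>2 / (\<gamma> * \<mu>) + Bw\<^sup>2 * B\<theta>\<^sup>2 / \<mu>\<^sup>2"
    and \<alpha>\<theta>_eq: "\<alpha>\<theta> = 1 / (real nX * \<mu> * (64 * \<kappa> + 1))"
    and \<alpha>w_eq: "\<alpha>w = real nX * \<mu> / \<gamma> * \<alpha>\<theta>"
begin

definition F :: "nat \<Rightarrow> nat \<Rightarrow> real^'d \<Rightarrow> real^'l" where
  "F i j \<theta> = f \<theta> (x i) (y i j)"

definition J :: "nat \<Rightarrow> nat \<Rightarrow> real^'d \<Rightarrow> real^'l \<Rightarrow> real^'d" where
  "J i j \<theta> v = fprime f \<theta> (x i) (y i j) *v v"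

definition conj_dom :: "nat \<Rightarrow> (real^'l) set" where
  "conj_dom i = {v. convex_conjugate (\<phi> i) v < \<infinity>}"

definition prox_g :: "real^'d \<Rightarrow> real^'d \<Rightarrow> real^'d" where
  "prox_g d \<theta> = arg_min (\<lambda>\<eta>. d \<bullet> \<eta> + g \<eta> + 1 / (2 * \<alpha>\<theta>) * (norm (\<eta> - \<theta>))\<^sup>2) (\<lambda>_. True)"

definition prox_conj :: "nat \<Rightarrow> real^'l \<Rightarrow> real^'l \<Rightarrow> real^'l" where
  "prox_conj i \<delta> w = arg_min (\<lambda>v. ereal (- (\<delta> \<bullet> v)) + convex_conjugate (\<phi> i) v
     + ereal (1 / (2 * \<alpha>w) * (norm (v - w))\<^sup>2)) (\<lambda>_. True)"

sublocale composition_data nX nY F J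
  by unfold_locales (use nX_ge nY_ge in auto)

lemma Fbar_eq: "Fbar i \<theta> = fbar nY x y f \<theta> i"
  by (simp add: Fbar_def F_def fbar_eq_mean)

lemma Lgrad_eq: "Lgrad \<theta> w = mean nX (\<lambda>i. fbar_prime nY x y f \<theta> i *v w i)"
  by (simp add: Lgrad_def avg_def J_def fbar_prime_mult_vec)

lemma \<phi>_GDERIV: "i < nX \<Longrightarrow> GDERIV (\<phi> i) u :> grad (\<phi> i) u"
  using \<phi>_smooth GDERIV_grad unfolding smooth_function_def by blast

lemma grad_in_conj_dom: "i < nX \<Longrightarrow> grad (\<phi> i) u \<in> conj_dom i"
  using conjugate_grad[OF \<phi>_convex \<phi>_GDERIV] by (simp add: conj_dom_def)

text \<open>Places \<open>ws i\<close> in the domain and gives it the form \<open>grad h u\<close>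
  required by \<open>conjugate_prox_step\<close>, with \<open>u = Fbar i \<theta>s\<close>.\<close>

lemma ws_eq: "i < nX \<Longrightarrow> ws i = grad (\<phi> i) (Fbar i \<theta>s)"
  using saddle unfolding saddle_point_def Fbar_eq
  by (blast intro: conjugate_arg_min \<phi>_convex \<phi>_GDERIV)

lemma GDERIV_Lagrangian:
  "GDERIV (\<lambda>\<eta>. mean nX (\<lambda>i. fbar nY x y f \<eta> i \<bullet> w i - c i)) \<theta> :> Lgrad \<theta> w"
proof -
  have "GDERIV (\<lambda>\<eta>. fbar nY x y f \<eta> i \<bullet> w i - c i) \<theta> :> mean (nY i) (\<lambda>j. J i j \<theta> (w i))" for i
    using GDERIV_diff[OF GDERIV_mean GDERIV_const, OF GDERIV_inner_fprime[OF f_diff]]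
    unfolding fbar_eq_mean mean_inner_left[symmetric] J_def by simp
  then show ?thesis unfolding Lgrad_def avg_def by (intro GDERIV_mean)
qed

lemma alpha_pos: "\<alpha>\<theta> > 0" "\<alpha>w > 0"
proof -
  have "\<kappa> \<ge> 0" using constants_pos by (simp add: \<kappa>_eq)
  then show "\<alpha>\<theta> > 0" using constants_pos nX_ge by (simp add: \<alpha>\<theta>_eq)
  then show "\<alpha>w > 0" using constants_pos nX_ge by (simp add: \<alpha>w_eq)
qed

sublocale svrpda_rates nX nY F J conj_dom \<theta>s ws \<mu> \<gamma> Bw B\<theta> Bf \<alpha>\<theta> \<alpha>w prox_g prox_conj \<kappa>
proof
  show "\<mu> > 0" "\<gamma> > 0" "Bw > 0" "B\<theta> > 0" "Bf > 0" "\<alpha>\<theta> > 0" "\<alpha>w > 0"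
    by (fact constants_pos alpha_pos)+
  show "J i j \<theta> (v - w) = J i j \<theta> v - J i j \<theta> w" for i j \<theta> v w
    by (simp add: J_def matrix_vector_mult_diff_distrib)
  show "norm (J i j \<theta> w) \<le> Bf * norm w" if "i < nX" "j < nY i" for i j \<theta> w
    using order_trans[OF onorm[OF matrix_vector_mul_bounded_linear] mult_right_mono[OF fprime_bound[OF that] norm_ge_zero]]
    by (simp add: J_def)
  show "norm (J i j \<theta> w - J i j \<theta>' w) \<le> B\<theta> * norm (\<theta> - \<theta>') * norm w" if "i < nX" "j < nY i" for i j \<theta> \<theta>' w
    using order_trans[OF onorm[OF matrix_vector_mul_bounded_linear] mult_right_mono[OF fprime_lip[OF that] norm_ge_zero]]
    by (simp add: J_def matrix_vector_mult_diff_rdistrib[symmetric])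
  show "norm (F i j \<theta> - F i j \<theta>') \<le> Bf * norm (\<theta> - \<theta>')" if "i < nX" "j < nY i" for i j \<theta> \<theta>'
    unfolding F_def by (intro fprime_bound_imp_lipschitz f_diff fprime_bound that)
  show "norm w \<le> Bw" if "i < nX" "w \<in> conj_dom i" for i w
    using that conjugate_finite_imp_bounded[OF \<phi>_lip] constants_pos by (auto simp: conj_dom_def)
  show "ws i \<in> conj_dom i" if "i < nX" for i
    using that by (simp add: ws_eq grad_in_conj_dom)
  show "(\<theta> - \<theta>') \<bullet> Lgrad \<theta>' v \<le> mean nX (\<lambda>i. (Fbar i \<theta> - Fbar i \<theta>') \<bullet> v i)"
    if "\<And>i. i < nX \<Longrightarrow> v i \<in> conj_dom i" for \<theta> \<theta>' v
  proof -
    have fin: "\<And>i. i < nX \<Longrightarrow> convex_conjugate (\<phi> i) (v i) < \<infinity>" using that by (simp add: conj_dom_def)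
    have lag: "lagrangian nX nY x y f \<phi> \<eta> v = ereal (mean nX (\<lambda>i. fbar nY x y f \<eta> i \<bullet> v i
        - real_of_ereal (convex_conjugate (\<phi> i) (v i))))" for \<eta>
      using fin by (rule lagrangian_finite)
    have "grad (\<lambda>\<theta>. real_of_ereal (lagrangian nX nY x y f \<phi> \<theta> v)) \<theta>' = Lgrad \<theta>' v"
      unfolding lag real_of_ereal.simps
      by (rule GDERIV_grad_eq[OF GDERIV_Lagrangian])
    then have "Lgrad \<theta>' v \<bullet> (\<theta> - \<theta>')
        \<le> mean nX (\<lambda>i. fbar nY x y f \<theta> i \<bullet> v i - real_of_ereal (convex_conjugate (\<phi> i) (v i)))
          - mean nX (\<lambda>i. fbar nY x y f \<theta>' i \<bullet> v i - real_of_ereal (convex_conjugate (\<phi> i) (v i)))"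
      using lagrangian_convex[OF fin, where ?\<theta>1.0 = \<theta> and ?\<theta>2.0 = \<theta>'] unfolding lag by simp
    also have "\<dots> = mean nX (\<lambda>i. (Fbar i \<theta> - Fbar i \<theta>') \<bullet> v i)"
      unfolding mean_diff[symmetric] Fbar_eq by (simp add: inner_diff_left)
    finally show ?thesis by (simp add: inner_commute)
  qed
  have prox: "\<exists>p. prox_conj i \<delta> w = grad (\<phi> i) p \<and> grad (\<phi> i) p = w + \<alpha>w *\<^sub>R (\<delta> - p)"
    if "i < nX" for i \<delta> w
  proof -
    have "\<phi> i differentiable (at u)" for u
      using \<phi>_smooth[OF that] unfolding smooth_function_def by blast
    from conjugate_prox[OF \<phi>_convex[OF that] this \<phi>_nonneg[OF that] alpha_pos(2), where \<delta> = \<delta> and w = w]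
    show ?thesis unfolding prox_conj_def[symmetric] by blast
  qed
  then show "prox_conj i \<delta> w \<in> conj_dom i" if "i < nX" for i \<delta> w
    using that grad_in_conj_dom by metis
  show "(1 / (2 * \<alpha>w)) * ((norm (prox_conj i \<delta> w - ws i))\<^sup>2 + (norm (prox_conj i \<delta> w - w))\<^sup>2
            - (norm (w - ws i))\<^sup>2) + \<gamma> * (norm (prox_conj i \<delta> w - ws i))\<^sup>2
          \<le> (prox_conj i \<delta> w - ws i) \<bullet> (\<delta> - Fbar i \<theta>s)" if i: "i < nX" for i \<delta> w
  proof -
    obtain p where p: "prox_conj i \<delta> w = grad (\<phi> i) p" "grad (\<phi> i) p = w + \<alpha>w *\<^sub>R (\<delta> - p)"
      using prox[OF i] by blast
    show ?thesis
      unfolding p(1) ws_eq[OF i]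
      by (rule conjugate_prox_step[OF \<phi>_smooth[OF i] \<phi>_convex[OF i] constants_pos(2) alpha_pos(2) p(2)])
  qed
  have fin: "\<And>i. i < nX \<Longrightarrow> convex_conjugate (\<phi> i) (ws i) < \<infinity>"
    using ws_eq grad_in_conj_dom by (simp add: conj_dom_def)
  define h where "h \<eta> = mean nX (\<lambda>i. fbar nY x y f \<eta> i \<bullet> ws i - real_of_ereal (convex_conjugate (\<phi> i) (ws i)))" for \<eta>
  have lag: "lagrangian nX nY x y f \<phi> \<eta> ws = ereal (h \<eta>)" for \<eta>
    unfolding h_def using fin by (rule lagrangian_finite)
  have "lagrangian nX nY x y f \<phi> \<theta>s ws + ereal (g \<theta>s) \<le> lagrangian nX nY x y f \<phi> v ws + ereal (g v)" for v
    using saddle unfolding saddle_point_def is_arg_min_linorder by blast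
  then have min: "h \<theta>s + g \<theta>s \<le> h v + g v" for v
    unfolding lag by simp
  have "GDERIV h \<theta>s :> Lgrad \<theta>s ws"
    using GDERIV_Lagrangian[of ws "\<lambda>i. real_of_ereal (convex_conjugate (\<phi> i) (ws i))" \<theta>s] unfolding h_def .
  then have "g v \<ge> g \<theta>s - (v - \<theta>s) \<bullet> Lgrad \<theta>s ws + \<mu> / 2 * (norm (v - \<theta>s))\<^sup>2" for v
    using min by (rule strongly_convex_min_ineq[OF g_strongly_convex])
  then show "(1 / (2 * \<alpha>\<theta>)) * ((norm (prox_g d \<theta> - \<theta>s))\<^sup>2 + (norm (prox_g d \<theta> - \<theta>))\<^sup>2
            - (norm (\<theta> - \<theta>s))\<^sup>2) + \<mu> * (norm (prox_g d \<theta> - \<theta>s))\<^sup>2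
          \<le> (\<theta>s - prox_g d \<theta>) \<bullet> (d - Lgrad \<theta>s ws)" for d \<theta>
    using prox_step[OF g_strongly_convex g_convex alpha_pos(1) constants_pos(1)] unfolding prox_g_def by blast
  show "\<kappa> = Bf\<^sup>2 / (\<gamma> * \<mu>) + Bw\<^sup>2 * B\<theta>\<^sup>2 / \<mu>\<^sup>2"
    "\<alpha>\<theta> = 1 / (real nX * \<mu> * (64 * \<kappa> + 1))" "\<alpha>w = real nX * \<mu> / \<gamma> * \<alpha>\<theta>"
    by (fact \<kappa>_eq \<alpha>\<theta>_eq \<alpha>w_eq)+
qed

section \<open>The algorithm as an instance of the abstract step\<close>

abbreviation step where "step \<equiv> svrpda_step nX nY x y f \<phi> g \<alpha>\<theta> \<alpha>w"

abbreviation stage where "stage \<equiv> svrpda_stage nX nY x y f \<phi> g \<alpha>\<theta> \<alpha>w"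

lemmas finite_sample = set_sample_index(2)[OF nX_ge nY_ge]

text \<open>\<open>Lgrad \<theta>\<close> is a sum over the coordinates of \<open>w\<close>, so the
  recursive update keeps \<open>U\<close> equal to the full gradient at the reference point, without
  accumulating error.\<close>

lemma Lgrad_update:
  assumes "i < nX"
  shows "Lgrad \<theta> w + (1 / real nX) *\<^sub>R (fbar_prime nY x y f \<theta> i *v (z - w i)) = Lgrad \<theta> (w(i := z))"
  unfolding Lgrad_eq mean_def sum_fun_upd[OF assms, of "\<lambda>l v. fbar_prime nY x y f \<theta> l *v v"]
  by (simp add: matrix_vector_mult_diff_distrib scaleR_diff_right scaleR_add_right)

lemma Lgrad_initial:
  "(\<Sum>i<nX. \<Sum>j<nY i. (1 / (real nX * real (nY i))) *\<^sub>R (fprime f \<theta> (x i) (y i j) *v w i)) = Lgrad \<theta> w"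
  by (simp add: Lgrad_def avg_def mean_def J_def scaleR_sum_right)

text \<open>On states whose \<open>U\<close> is \<open>Lgrad \<theta>t w\<close>, a relation that
  the step preserves, the concrete iteration is a dual step followed by an independent primal
  step.\<close>

lemma step_eq:
  "step \<theta>t (\<theta>, w, Lgrad \<theta>t w, q) = bind_pmf (sample_index nX nY) (\<lambda>(i, j).
     bind_pmf (sample_index nX nY) (\<lambda>(i', j'). return_pmf
       (primal_step \<theta>t \<theta> (dual_step \<theta>t \<theta> w i j) i' j', dual_step \<theta>t \<theta> w i j,
        Lgrad \<theta>t (dual_step \<theta>t \<theta> w i j), q + 5)))"
  unfolding svrpda_step_def Let_def prod.case
proof (intro bind_pmf_cong refl, goal_cases)
  case (1 p)
  then obtain i j where p: "p = (i, j)" and i: "i < nX"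
    by (auto simp: set_sample_index(1)[OF nX_ge nY_ge])
  define z where "z = prox_conj i (F i j \<theta> - F i j \<theta>t + Fbar i \<theta>t) (w i)"
  have z: "arg_min (\<lambda>v. ereal (- ((f \<theta> (x i) (y i j) - f \<theta>t (x i) (y i j) + fbar nY x y f \<theta>t i) \<bullet> v))
        + convex_conjugate (\<phi> i) v + ereal (1 / (2 * \<alpha>w) * (norm (v - w i))\<^sup>2)) (\<lambda>_. True) = z"
    unfolding z_def prox_conj_def F_def Fbar_eq ..
  have w': "w(i := z) = dual_step \<theta>t \<theta> w i j" by (simp add: dual_step_def z_def)
  show ?case
    unfolding p prod.case z fun_upd_same Lgrad_update[OF i] w'
    by (simp only: primal_step_def prox_g_def J_def)
qed

lemma finite_step: "finite (set_pmf (step \<theta>t st))"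
  unfolding svrpda_step_def Let_def by (auto simp: split_beta finite_sample)

lemma step_counter: "st' \<in> set_pmf (step \<theta>t st) \<Longrightarrow> snd (snd (snd st')) = snd (snd (snd st)) + 5"
  unfolding svrpda_step_def Let_def by (auto simp: split_beta)

lemma expectation_step:
  fixes h :: "real^'d \<Rightarrow> (nat \<Rightarrow> real^'l) \<Rightarrow> real"
  shows "measure_pmf.expectation (step \<theta>t (\<theta>, w, Lgrad \<theta>t w, q)) (\<lambda>(\<theta>, w, U, q). h \<theta> w)
    = avg (\<lambda>i j. avg (\<lambda>i' j'. h (primal_step \<theta>t \<theta> (dual_step \<theta>t \<theta> w i j) i' j') (dual_step \<theta>t \<theta> w i j)))"
  unfolding step_eq avg_def
  by (simp add: expectation_sample_index_bind[OF nX_ge nY_ge] finite_sample split_beta)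

text \<open>The factor 95/96 on the left and 5/8 on the right combine to 12/19, below 3/4.\<close>

lemma stage_expectation:
  assumes M: "real M \<ge> 78.8 * real nX * \<kappa> + 1.3 * real nX + 1.3"
  shows "measure_pmf.expectation (stage M st) (\<lambda>(\<theta>, w, q). lyapunov \<theta> w)
    \<le> 3 / 4 * (case st of (\<theta>, w, q) \<Rightarrow> lyapunov \<theta> w)"
proof -
  obtain \<theta>t wt q where st: "st = (\<theta>t, wt, q)" by (cases st)
  let ?p = "iterate_pmf (step \<theta>t) M (\<theta>t, wt, Lgrad \<theta>t wt, q + 2 * (\<Sum>i<nX. nY i))"
  let ?I = "{(\<theta>, w, U, q). U = Lgrad \<theta>t w} :: ((real^'d) \<times> (nat \<Rightarrow> real^'l) \<times> (real^'d) \<times> nat) set"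
  let ?h = "\<lambda>(\<theta>, w, U, q). potential \<theta> w"
  let ?K = "\<mu> / 2 * scale"
  have K: "?K > 0" using constants_pos scale_gt(2) by simp
  have fin: "finite (set_pmf ?p)" by (intro finite_set_iterate_pmf finite_step)
  define e where "e = measure_pmf.expectation (stage M st) (\<lambda>(\<theta>, w, q). lyapunov \<theta> w)"
  have "e = measure_pmf.expectation ?p (\<lambda>(\<theta>, w, U, q). lyapunov \<theta> w)"
    unfolding e_def svrpda_stage_def st Let_def prod.case Lgrad_initial
    by (subst expectation_bind_finite[OF fin]) (simp_all add: case_prod_unfold)
  then have "95 / 96 * ?K * e = measure_pmf.expectation ?p (\<lambda>(\<theta>, w, U, q). 95 / 96 * ?K * lyapunov \<theta> w)"
    by (simp add: case_prod_unfold)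
  also have "\<dots> \<le> measure_pmf.expectation ?p ?h"
    using lyapunov_le_potential by (intro expectation_mono_finite[OF fin]) (auto simp: mult.assoc)
  also have "\<dots> \<le> rate ^ M * potential \<theta>t wt + \<mu> / 32 * (norm (\<theta>t - \<theta>s))\<^sup>2 * (\<Sum>i<M. rate ^ i)"
  proof -
    have drift: "measure_pmf.expectation (step \<theta>t s) ?h \<le> rate * ?h s + \<mu> / 32 * (norm (\<theta>t - \<theta>s))\<^sup>2"
      if "s \<in> ?I" for s
      using that potential_step[of \<theta>t] by (auto simp: expectation_step)
    have inv: "set_pmf (step \<theta>t s) \<subseteq> ?I" if "s \<in> ?I" for s
      using that by (cases s) (auto simp: step_eq split_beta)
    show ?thesis
      using iterate_pmf_drift[of "step \<theta>t" _ ?I ?h, OF finite_step _ inv drift rate_bounds(1)]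
      by fastforce
  qed
  also have "\<dots> \<le> 1 / 2 * potential \<theta>t wt + \<mu> / 32 * (norm (\<theta>t - \<theta>s))\<^sup>2 * (1 / (1 - rate))"
  proof (intro add_mono mult_mono)
    have "lyapunov \<theta>t wt \<ge> 0"
      unfolding lyapunov_def using constants_pos \<kappa>_nonneg dist_sq_nonneg by simp
    then have "95 / 96 * (?K * lyapunov \<theta>t wt) \<ge> 0" using K by simp
    then show "potential \<theta>t wt \<ge> 0" using lyapunov_le_potential[of \<theta>t wt] by linarith
    have "(\<Sum>i<M. rate ^ i) = (1 - rate ^ M) / (1 - rate)"
      using rate_bounds by (simp add: sum_gp_strict)
    also have "\<dots> \<le> 1 / (1 - rate)" using rate_bounds by (intro divide_right_mono) auto
    finally show "(\<Sum>i<M. rate ^ i) \<le> 1 / (1 - rate)" .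
  qed (use rate_power_le[OF M] rate_bounds constants_pos in \<open>auto intro: sum_nonneg\<close>)
  also have "\<dots> \<le> 5 / 8 * (?K * lyapunov \<theta>t wt)"
    using potential_initial[of \<theta>t wt] by simp
  finally have "?K * (95 / 96 * e) \<le> ?K * (5 / 8 * lyapunov \<theta>t wt)" by (simp only: mult_ac)
  then have "95 / 96 * e \<le> 5 / 8 * lyapunov \<theta>t wt" using K by (simp only: mult_le_cancel_left_pos)
  moreover have "lyapunov \<theta>t wt \<ge> 0"
    unfolding lyapunov_def using constants_pos \<kappa>_nonneg dist_sq_nonneg by simp
  ultimately have "e \<le> 3 / 4 * lyapunov \<theta>t wt" by linarith
  then show ?thesis by (simp add: st e_def)
qed

lemma finite_stage: "finite (set_pmf (stage M st))"
  unfolding svrpda_stage_def Let_def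
  by (auto simp: split_beta intro!: finite_set_iterate_pmf finite_step)

text \<open>The count is deterministic, so the cost bound holds on the whole support of the output
  law and not merely in expectation.\<close>

lemma stage_counter:
  assumes "st' \<in> set_pmf (stage M st)"
  shows "snd (snd st') = snd (snd st) + (2 * (\<Sum>i<nX. nY i) + M * 5)"
  using assms iterate_pmf_counter[where c = "\<lambda>st. snd (snd (snd st))" and d = 5 and k = M, OF step_counter]
  unfolding svrpda_stage_def Let_def by (fastforce simp: split_beta)

lemma lyapunov_decay:
  assumes M: "real M \<ge> 78.8 * real nX * \<kappa> + 1.3 * real nX + 1.3"
  shows "measure_pmf.expectation (svrpda nX nY x y f \<phi> g \<alpha>\<theta> \<alpha>w M \<theta>0 w0 s) (\<lambda>(\<theta>, w, q). lyapunov \<theta> w)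
    \<le> (3 / 4) ^ s * lyapunov \<theta>0 w0"
  using iterate_pmf_drift[of "stage M" "(\<theta>0, w0, 0)" UNIV "\<lambda>(\<theta>, w, q). lyapunov \<theta> w" "3 / 4" 0 s]
    stage_expectation[OF M] finite_stage
  unfolding svrpda_def by simp

lemma finite_svrpda: "finite (set_pmf (svrpda nX nY x y f \<phi> g \<alpha>\<theta> \<alpha>w M \<theta>0 w0 s))"
  unfolding svrpda_def by (intro finite_set_iterate_pmf finite_stage)

lemma svrpda_counter:
  assumes "(\<theta>, w, q) \<in> set_pmf (svrpda nX nY x y f \<phi> g \<alpha>\<theta> \<alpha>w M \<theta>0 w0 s)"
  shows "q = s * (2 * (\<Sum>i<nX. nY i) + M * 5)"
  using assms iterate_pmf_counter[where c = "\<lambda>st. snd (snd st)" and K = "stage M" and y = "(\<theta>, w, q)", OF stage_counter]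
  unfolding svrpda_def by fastforce

end

text \<open>Because \<open>ln (4 / 3)\<close> is at least 1/4, at most
  \<open>4 * m + 4 * l + 1\<close> stages are taken. The bound 1/2 on \<epsilon> forces
  \<open>l \<ge> 2 / 3\<close>, which lets multiples of \<open>l\<close> absorb the additive
  terms.\<close>

lemma geometric_decay_count:
  fixes p \<epsilon> :: real
  assumes \<epsilon>: "0 < \<epsilon>" "\<epsilon> \<le> 1 / 2"
  obtains s :: nat where "(3 / 4) ^ s * p \<le> \<epsilon>" "real s \<le> 6 * (1 + max 0 (ln p)) * ln (1 / \<epsilon>)"
proof -
  define m l r where "m = max 0 (ln p)" and "l = ln (1 / \<epsilon>)" and "r = ln (4 / 3 :: real)"
  have "ln (3 / 4 :: real) \<le> 3 / 4 - 1" by (rule ln_le_minus_one) simp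
  then have r: "r \<ge> 1 / 4" unfolding r_def using ln_inverse[of "3 / 4 :: real"] by simp
  have "ln 2 \<le> l" unfolding l_def using \<epsilon> by (simp add: field_simps)
  then have l: "l \<ge> 2 / 3" using ln2_ge_two_thirds by linarith
  have m: "m \<ge> 0" by (simp add: m_def)
  define s where "s = nat \<lceil>(m + l) / r\<rceil>"
  have "(m + l) / r \<ge> 0" using m l r by simp
  then have s: "(m + l) / r \<le> real s" "real s \<le> (m + l) / r + 1"
    unfolding s_def by linarith+
  show thesis
  proof (rule that)
    have "p \<le> exp m"
    proof (cases "p > 0")
      case True
      then have "p = exp (ln p)" by simp
      also have "\<dots> \<le> exp m" by (simp add: m_def)
      finally show ?thesis .
    next
      case False
      then show ?thesis using exp_gt_zero[of m] by linarith
    qed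
    moreover have "(3 / 4) ^ s = exp (- (real s * r))"
      by (simp add: r_def exp_minus exp_of_nat_mult power_divide)
    moreover have "exp (- (real s * r)) \<le> exp (- (m + l))"
      using s(1) r by (simp add: field_simps)
    ultimately have "(3 / 4) ^ s * p \<le> exp (- (m + l)) * exp m"
      by (smt (verit) exp_gt_zero mult_left_mono mult_right_mono)
    also have "\<dots> = \<epsilon>"
      using \<epsilon> by (simp add: l_def ln_div flip: exp_add)
    finally show "(3 / 4) ^ s * p \<le> \<epsilon>" .
    have "(m + l) / r \<le> (m + l) / (1 / 4)" using r m l by (intro divide_left_mono) auto
    then have "real s \<le> 4 * m + 4 * l + 1" using s(2) by simp
    also have "\<dots> \<le> 6 * (1 + m) * l"
      using mult_left_mono[OF l m] l by (simp add: algebra_simps)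
    finally show "real s \<le> 6 * (1 + max 0 (ln p)) * ln (1 / \<epsilon>)" by (simp add: m_def l_def)
  qed
qed

theorem theorem4p5:
  fixes nX :: nat and nY :: "nat \<Rightarrow> nat"
    and x :: "nat \<Rightarrow> real^'mx" and y :: "nat \<Rightarrow> nat \<Rightarrow> real^'my"
    and f :: "real^'d \<Rightarrow> real^'mx \<Rightarrow> real^'my \<Rightarrow> real^'l"
    and \<phi> :: "nat \<Rightarrow> real^'l \<Rightarrow> real" and g :: "real^'d \<Rightarrow> real"
    and \<mu> \<gamma> B\<^sub>w B\<^sub>\<theta> B\<^sub>f \<kappa> \<alpha>\<^sub>\<theta> \<alpha>\<^sub>w nYavg :: real and M :: nat
    and \<theta>s \<theta>0 :: "real^'d" and ws w0 :: "nat \<Rightarrow> real^'l"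
    and P :: "nat \<Rightarrow> real"
  assumes nX: "nX \<ge> 1" and nY: "\<And>i. i < nX \<Longrightarrow> nY i \<ge> 1"
    and f_diff: "\<And>\<theta> a b. (\<lambda>\<eta>. f \<eta> a b) differentiable (at \<theta>)"
    and \<phi>_nonneg: "\<And>i u. i < nX \<Longrightarrow> \<phi> i u \<ge> 0"
    and \<phi>_convex: "\<And>i. i < nX \<Longrightarrow> convex_on UNIV (\<phi> i)"
    and g_convex: "convex_on UNIV g"
    and saddle: "saddle_point nX nY x y f \<phi> g \<theta>s ws"
    and pos: "\<mu> > 0" "\<gamma> > 0" "B\<^sub>w > 0" "B\<^sub>\<theta> > 0" "B\<^sub>f > 0"
    and A1: "strongly_convex \<mu> g" "\<And>i. i < nX \<Longrightarrow> smooth_function (1 / \<gamma>) (\<phi> i)"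
    and A2: "\<And>i u u'. i < nX \<Longrightarrow> \<bar>\<phi> i u - \<phi> i u'\<bar> \<le> B\<^sub>w * norm (u - u')"
    and A3: "\<And>i j \<theta>1 \<theta>2. i < nX \<Longrightarrow> j < nY i \<Longrightarrow>
               onorm (\<lambda>v. (fprime f \<theta>1 (x i) (y i j) - fprime f \<theta>2 (x i) (y i j)) *v v)
                 \<le> B\<^sub>\<theta> * norm (\<theta>1 - \<theta>2)"
            "\<And>i j \<theta>. i < nX \<Longrightarrow> j < nY i \<Longrightarrow>
               onorm (\<lambda>v. fprime f \<theta> (x i) (y i j) *v v) \<le> B\<^sub>f"
    and A4: "\<And>w \<theta>1 \<theta>2. (\<And>i. i < nX \<Longrightarrow> convex_conjugate (\<phi> i) (w i) < \<infinity>) \<Longrightarrow>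
               lagrangian nX nY x y f \<phi> \<theta>1 w - lagrangian nX nY x y f \<phi> \<theta>2 w
                 \<ge> ereal (grad (\<lambda>\<theta>. real_of_ereal (lagrangian nX nY x y f \<phi> \<theta> w)) \<theta>2
                            \<bullet> (\<theta>1 - \<theta>2))"
    and \<kappa>: "\<kappa> = B\<^sub>f\<^sup>2 / (\<gamma> * \<mu>) + B\<^sub>w\<^sup>2 * B\<^sub>\<theta>\<^sup>2 / \<mu>\<^sup>2"
    and \<alpha>\<^sub>\<theta>: "\<alpha>\<^sub>\<theta> = 1 / (real nX * \<mu> * (64 * \<kappa> + 1))"
    and \<alpha>\<^sub>w: "\<alpha>\<^sub>w = real nX * \<mu> / \<gamma> * \<alpha>\<^sub>\<theta>"
    and M: "M = nat \<lceil>78.8 * real nX * \<kappa> + 1.3 * real nX + 1.3\<rceil>"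
    and P: "\<And>s. P s =
              measure_pmf.expectation (svrpda nX nY x y f \<phi> g \<alpha>\<^sub>\<theta> \<alpha>\<^sub>w M \<theta>0 w0 s)
                (\<lambda>(\<theta>, w, q). (norm (\<theta> - \<theta>s))\<^sup>2)
              + \<gamma> / \<mu> * ((64 * \<kappa> + 3) / (64 * real nX * \<kappa> + real nX + 1))
                * measure_pmf.expectation (svrpda nX nY x y f \<phi> g \<alpha>\<^sub>\<theta> \<alpha>\<^sub>w M \<theta>0 w0 s)
                    (\<lambda>(\<theta>, w, q). \<Sum>i<nX. (norm (w i - ws i))\<^sup>2)"
    and nYavg: "nYavg = (\<Sum>i<nX. real (nY i)) / real nX"
  shows "(\<forall>s. P s \<le> (3 / 4) ^ s * P 0) \<and>
         (\<forall>\<epsilon>. 0 < \<epsilon> \<and> \<epsilon> \<le> 1 / 2 \<longrightarrow>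
            (\<exists>s. P s \<le> \<epsilon> \<and>
               (\<forall>(\<theta>, w, q) \<in> set_pmf (svrpda nX nY x y f \<phi> g \<alpha>\<^sub>\<theta> \<alpha>\<^sub>w M \<theta>0 w0 s).
                  real q \<le> oracle_const (P 0)
                             * (real nX * nYavg + real nX * \<kappa> + real nX) * ln (1 / \<epsilon>))))"
proof -
  interpret svrpda_problem nX nY x y f \<phi> g \<mu> \<gamma> B\<^sub>w B\<^sub>\<theta> B\<^sub>f \<kappa> \<alpha>\<^sub>\<theta> \<alpha>\<^sub>w \<theta>s ws
    by unfold_locales (fact nX nY f_diff \<phi>_nonneg \<phi>_convex g_convex saddle pos A1 A2 A3 A4 \<kappa> \<alpha>\<^sub>\<theta> \<alpha>\<^sub>w)+
  let ?S = "\<lambda>s. svrpda nX nY x y f \<phi> g \<alpha>\<^sub>\<theta> \<alpha>\<^sub>w M \<theta>0 w0 s"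
  have M_ge: "real M \<ge> 78.8 * real nX * \<kappa> + 1.3 * real nX + 1.3"
    unfolding M by (rule real_nat_ceiling_ge)
  have P_eq: "P s = measure_pmf.expectation (?S s) (\<lambda>(\<theta>, w, q). lyapunov \<theta> w)" for s
    unfolding P lyapunov_def dist_sq_def
    by (simp add: case_prod_unfold integrable_measure_pmf_finite[OF finite_svrpda])
  have "P 0 = lyapunov \<theta>0 w0" unfolding P_eq by (simp add: svrpda_def)
  then have decay: "P s \<le> (3 / 4) ^ s * P 0" for s
    using lyapunov_decay[OF M_ge, of \<theta>0 w0 s] by (simp add: P_eq)
  have "\<exists>s. P s \<le> \<epsilon> \<and> (\<forall>(\<theta>, w, q) \<in> set_pmf (?S s).
      real q \<le> oracle_const (P 0) * (real nX * nYavg + real nX * \<kappa> + real nX) * ln (1 / \<epsilon>))"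
    if \<epsilon>: "0 < \<epsilon>" "\<epsilon> \<le> 1 / 2" for \<epsilon>
  proof -
    obtain s where s: "(3 / 4) ^ s * P 0 \<le> \<epsilon>" "real s \<le> 6 * (1 + max 0 (ln (P 0))) * ln (1 / \<epsilon>)"
      using geometric_decay_count[OF \<epsilon>] by blast
    define T where "T = real nX * nYavg + real nX * \<kappa> + real nX"
    define l where "l = ln (1 / \<epsilon>)"
    have l: "l \<ge> 0" unfolding l_def using \<epsilon> by simp
    have sumY: "real (\<Sum>i<nX. nY i) = real nX * nYavg" using nX by (simp add: nYavg)
    have avg0: "real nX * nYavg \<ge> 0" unfolding sumY[symmetric] by (simp add: sum_nonneg)
    have k0: "real nX * \<kappa> \<ge> 0" using \<kappa>_nonneg by simp
    have ceil: "real (nat \<lceil>z\<rceil>) \<le> z + 1" if "z \<ge> 0" for z :: real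
      using that by linarith
    have "real M \<le> 78.8 * real nX * \<kappa> + 1.3 * real nX + 1.3 + 1"
      unfolding M using \<kappa>_nonneg by (intro ceil) simp
    then have M_le: "real M \<le> 78.8 * (real nX * \<kappa>) + 1.3 * real nX + 1.3 + 1" by simp
    \<comment> \<open>394 is 5 * 78.8, the coefficient of \<open>real nX * \<kappa>\<close>; the
      other coefficients are far smaller. Multiplied by the 6 from the number of stages it gives
      2364, below the 2500 in \<open>oracle_const\<close>.\<close>
    have "real (2 * (\<Sum>i<nX. nY i) + M * 5) \<le> 394 * T"
    proof -
      have "real (2 * (\<Sum>i<nX. nY i) + M * 5) = 2 * (real nX * nYavg) + 5 * real M"
        unfolding of_nat_add of_nat_mult sumY by simp
      moreover have "real nX \<ge> 1" using nX by simp
      ultimately show ?thesis using M_le avg0 k0 unfolding T_def distrib_left by linarith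
    qed
    then have "real s * real (2 * (\<Sum>i<nX. nY i) + M * 5) \<le> 6 * (1 + max 0 (ln (P 0))) * l * (394 * T)"
      using s(2) l unfolding l_def[symmetric] by (intro mult_mono of_nat_0_le_iff) auto
    also have "\<dots> = 2364 * ((1 + max 0 (ln (P 0))) * T * l)" by simp
    also have "\<dots> \<le> 2500 * ((1 + max 0 (ln (P 0))) * T * l)"
      using l avg0 k0 by (intro mult_right_mono mult_nonneg_nonneg) (auto simp: T_def)
    also have "\<dots> = oracle_const (P 0) * T * l" by (simp add: oracle_const_def)
    finally have "real s * real (2 * (\<Sum>i<nX. nY i) + M * 5) \<le> oracle_const (P 0) * T * l" .
    then have "real q \<le> oracle_const (P 0) * T * l" if "(\<theta>, w, q) \<in> set_pmf (?S s)" for \<theta> w q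
      unfolding svrpda_counter[OF that] by simp
    moreover have "P s \<le> \<epsilon>" using decay[of s] s(1) by linarith
    ultimately show ?thesis unfolding T_def l_def by blast
  qed
  with decay show ?thesis by blast
qed

end
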